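(* Let $X, X_1, X_2,\ldots$ be i.i.d. real random variables with distribution $F$ and mean $\mu$, let $\psi(\theta)=\log E[e^{\theta X}]$ and $\mathcal D=\{\theta:\psi(\theta)<\infty\}$. Let $b>\mu$ and $\gamma=bn$. Suppose that either $F$ is lattice with $0<P(X=b)<1$, or $F$ is non-lattice. Suppose $0\in\mathcal D^\circ$ and there is a unique $\theta^*\in\mathcal D^\circ$ with $\psi'(\theta^* )=b$. Let $u=u(n)$ be a truncation level for which there exists $\theta'>0$ with $\theta^*+\theta'\in\mathcal D^\circ$ and $\lim_{n\to\infty}ne^{-\theta' u}=0$. Then, as $n\to\infty$, $$p(\tilde F_u)-p(F)=o(p(F)).$$
   Context: $S_n=X_1+\cdots+X_n$. For a distribution $G$, $p(G)=P_G(S_n>\gamma)$ is the probability that $S_n>\gamma$ when $X_1,\ldots,X_n$ are i.i.d. with law $G$. The truncated distribution $\tilde F_u$ is $\tilde F_u(x)=F(x)/F(u)$ for $x\le u$ and $1$ for $x>u$. $\mathcal D^\circ$ is the interior of $\mathcal D$. $F$ is lattice if $(X-x_0)/h$ is a.s. an integer for some $x_0$ and $h>0$; the span is the largest such $h$. $a_n=o(b_n)$ means $a_n/b_n\to 0$. *)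

theory Defs
  imports "HOL-Probability.Probability" "HOL-Library.Landau_Symbols"
begin

definition cgf :: "real measure \<Rightarrow> real \<Rightarrow> real" where
  "cgf F \<theta> = ln (\<integral>x. exp (\<theta> * x) \<partial>F)"

definition cgf_dom :: "real measure \<Rightarrow> real set" where
  "cgf_dom F = {\<theta>. (\<integral>\<^sup>+x. ennreal (exp (\<theta> * x)) \<partial>F) < \<infinity>}"

definition lattice_distr :: "real measure \<Rightarrow> bool" where
  "lattice_distr F \<longleftrightarrow> (\<exists>x0 h. h > 0 \<and> (AE x in F. (x - x0) / h \<in> \<int>))"

definition tail_prob :: "nat \<Rightarrow> real \<Rightarrow> real measure \<Rightarrow> real" where
  "tail_prob n \<gamma> G = measure (PiM {..<n} (\<lambda>_. G))
      {x \<in> space (PiM {..<n} (\<lambda>_. G)). (\<Sum>i<n. x i) > \<gamma>}"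

text \<open>Truncated distribution: F(x)/F(u) for x \<le> u, 1 for x > u,
  i.e. the law of X conditioned on X \<le> u.\<close>
definition trunc_distr :: "real measure \<Rightarrow> real \<Rightarrow> real measure" where
  "trunc_distr F u = uniform_measure F {..u}"

end

theory Submission
  imports Defs
begin

text \<open>
  Let \<open>G\<close> be the law \<open>F\<close> tilted by \<open>exp (\<theta>\<^sup>* x)\<close>; it has mean \<open>b\<close>, and \<open>\<theta>\<^sup>* > 0\<close>. Up to the common factor
  \<open>exp (n (\<psi> \<theta>\<^sup>* - \<theta>\<^sup>* b))\<close>, the tail probability is at least of order \<open>1 / sqrt n\<close>, because the sum under
  \<open>G\<close> falls just above \<open>b n\<close> with such a probability. Up to the same factor, the event that the sum is
  large and some summand exceeds \<open>u\<close> has probability at most of order \<open>n G {u<..} / sqrt n\<close>: given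
  the large summand, the remaining sum still concentrates no more than \<open>1 / sqrt n\<close> on bounded
  intervals. The Chernoff bound \<open>G {u<..} = O (exp (- \<theta>' u))\<close> makes the quotient vanish.

  Both \<open>1 / sqrt n\<close> estimates come from Fourier inversion against the Fejer kernel, whose transform is
  supported in \<open>{-1..1}\<close>. Only the characteristic function near \<open>0\<close> then matters, so that lattice and
  non-lattice laws need no separate treatment: it is enough that \<open>F\<close> is not a point mass at \<open>b\<close>.
\<close>

subsection \<open>The Fejer kernel\<close>

definition tri :: "real \<Rightarrow> real" where
  "tri t = max 0 (1 - \<bar>t\<bar>)"

text \<open>Up to normalisation this is the Fejer kernel \<open>(sin (x / 2) / (x / 2))^2\<close>.
  Taking its Fourier integral as the definition makes inversion a matter of Fubini, and gives the
  right value at \<open>x = 0\<close>, where the closed form divides by zero.\<close>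

definition fejer :: "real \<Rightarrow> real" where
  "fejer x = (LBINT t. tri t * cos (t * x))"

lemma tri_nonneg: "0 \<le> tri t"
  and tri_le_1: "tri t \<le> 1"
  and tri_eq_0: "1 \<le> \<bar>t\<bar> \<Longrightarrow> tri t = 0"
  by (auto simp: tri_def)

lemma tri_measurable [measurable]: "tri \<in> borel_measurable borel"
  unfolding tri_def[abs_def] by measurable

lemma continuous_on_tri: "continuous_on A tri"
  unfolding tri_def[abs_def] by (intro continuous_intros)

lemma integrable_tri_times:
  assumes [measurable]: "g \<in> borel_measurable borel" and bd: "\<And>t. norm (g t) \<le> (1::real)"
  shows "integrable lborel (\<lambda>t. tri t * g t)"
proof (rule integrableI_bounded_set[where A = "{-1..1}" and B = 1])
  show "AE t\<in>{-1..1} in lborel. norm (tri t * g t) \<le> 1"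
    using bd tri_nonneg tri_le_1 by (auto simp: abs_mult intro!: mult_le_one)
qed (auto simp: tri_eq_0)

lemma integrable_tri: "integrable lborel tri"
  using integrable_tri_times[of "\<lambda>_. 1"] by simp

lemma has_integral_fejer_half:
  fixes x :: real
  assumes "x \<noteq> 0"
  shows "((\<lambda>t. (1 - t) * cos (t * x)) has_integral (1 - cos x) / x\<^sup>2) {0..1}"
proof -
  let ?F = "\<lambda>t. (1 - t) * sin (t * x) / x - cos (t * x) / x\<^sup>2"
  have "((\<lambda>t. (1 - t) * cos (t * x)) has_integral (?F 1 - ?F 0)) {0..1}"
    using assms
    by (intro fundamental_theorem_of_calculus)
       (auto intro!: derivative_eq_intros simp: has_real_derivative_iff_has_vector_derivative[symmetric] field_simps power2_eq_square)
  then show ?thesis by (simp add: diff_divide_distrib)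
qed

lemma fejer_eq:
  assumes "x \<noteq> 0"
  shows "fejer x = 2 * (1 - cos x) / x\<^sup>2"
proof -
  have 1: "((\<lambda>t. tri t * cos (t * x)) has_integral (1 - cos x) / x\<^sup>2) {0..1}"
    using has_integral_fejer_half[OF assms]
    by (rule has_integral_eq[rotated]) (auto simp: tri_def max_def)
  then have "((\<lambda>t. tri (- t) * cos (- t * x)) has_integral (1 - cos x) / x\<^sup>2) {- 1..- 0}"
    by (subst has_integral_reflect_real) (auto simp: tri_def)
  then have 2: "((\<lambda>t. tri t * cos (t * x)) has_integral (1 - cos x) / x\<^sup>2) {-1..0}"
    by (simp add: tri_def)
  have "((\<lambda>t. tri t * cos (t * x)) has_integral (1 - cos x) / x\<^sup>2 + (1 - cos x) / x\<^sup>2) {-1..1}"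
    by (rule has_integral_combine[OF _ _ 2 1]) auto
  then have "((\<lambda>t. tri t * cos (t * x)) has_integral (1 - cos x) / x\<^sup>2 + (1 - cos x) / x\<^sup>2) UNIV"
    by (rule has_integral_on_superset) (auto simp: tri_eq_0)
  moreover have "((\<lambda>t. tri t * cos (t * x)) has_integral fejer x) UNIV"
    unfolding fejer_def by (intro has_integral_integral_lborel integrable_tri_times) auto
  ultimately have "fejer x = (1 - cos x) / x\<^sup>2 + (1 - cos x) / x\<^sup>2"
    by (rule has_integral_unique[symmetric])
  then show ?thesis by (simp add: field_simps)
qed

lemma fejer_le:
  assumes "x \<noteq> 0"
  shows "fejer x \<le> 4 / x\<^sup>2"
proof -
  have "2 * (1 - cos x) \<le> 4" using cos_ge_minus_one[of x] by argo
  then show ?thesis using assms by (simp add: fejer_eq divide_right_mono)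
qed

lemma fejer_0_nonneg: "0 \<le> fejer 0"
  unfolding fejer_def by (simp add: tri_nonneg)

text \<open>At \<open>x = 0\<close> the quotient is \<open>0\<close>, because division by zero
  yields \<open>0\<close>; so the inequality, unlike the closed form, holds for every
  \<open>x\<close>.\<close>

lemma fejer_ge: "2 * (1 - cos x) / x\<^sup>2 \<le> fejer x"
  using fejer_eq[of x] fejer_0_nonneg by (cases "x = 0") auto

lemma fejer_nonneg: "0 \<le> fejer x"
proof (cases "x = 0")
  case False
  then show ?thesis using fejer_eq[OF False] cos_le_one[of x] by simp
qed (simp add: fejer_0_nonneg)

lemma integral_tri: "(LBINT t. tri t) = 1"
proof -
  have "((\<lambda>t. 1 - \<bar>t\<bar>) has_integral (1/2)) {0..1::real}"
  proof -
    have "((\<lambda>t. 1 - t) has_integral ((\<lambda>t. t - t^2/2) 1 - (\<lambda>t. t - t^2/2) 0)) {0..1::real}"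
      by (intro fundamental_theorem_of_calculus)
       (auto intro!: derivative_eq_intros simp: has_real_derivative_iff_has_vector_derivative[symmetric])
    then have "((\<lambda>t. 1 - t) has_integral (1/2)) {0..1::real}" by simp
    then show ?thesis by (rule has_integral_eq[rotated]) auto
  qed
  then have 1: "(tri has_integral (1/2)) {0..1}"
    by (rule has_integral_eq[rotated]) (auto simp: tri_def)
  then have "((\<lambda>t. tri (- t)) has_integral (1/2)) {- 1..- 0}"
    by (subst has_integral_reflect_real) (auto simp: tri_def)
  then have 2: "(tri has_integral (1/2)) {-1..0}" by (simp add: tri_def[abs_def])
  have "(tri has_integral 1/2 + 1/2) {-1..1}"
    by (rule has_integral_combine[OF _ _ 2 1]) auto
  then have "(tri has_integral 1/2 + 1/2) UNIV"
    by (rule has_integral_on_superset) (auto simp: tri_eq_0)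
  then show ?thesis
    using has_integral_unique[OF has_integral_integral_lborel[OF integrable_tri]] by fastforce
qed

lemma fejer_le_1: "fejer x \<le> 1"
proof -
  have "fejer x \<le> (LBINT t. tri t)"
    unfolding fejer_def
    by (intro integral_mono integrable_tri_times integrable_tri)
       (auto intro!: mult_left_le simp: tri_nonneg)
  then show ?thesis by (simp add: integral_tri)
qed

lemma fejer_measurable [measurable]: "fejer \<in> borel_measurable borel"
  unfolding fejer_def[abs_def] by measurable

text \<open>Shifting by \<open>\<plusminus>\<pi>/2\<close> turns \<open>1 - cos\<close> into \<open>1 \<mp> sin\<close>, so the zeros of the two translates of
  the Fejer kernel do not overlap.\<close>

lemma cauchy_le_fejer: "1 / (1 + x\<^sup>2) \<le> 2 * (fejer (x - pi / 2) + fejer (x + pi / 2))"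
proof -
  \<comment> \<open>A common upper bound for the squares of \<open>x - pi / 2\<close> and
    \<open>x + pi / 2\<close>. Over this single denominator the numerators \<open>1 - sin x\<close>
    and \<open>1 + sin x\<close> add up to a constant.\<close>
  define d where "d = (\<bar>x\<bar> + pi / 2)\<^sup>2"
  have pi: "3 < pi" "pi < 4" using pi_gt3 pi_less_4 by auto
  have dpos: "d > 0" unfolding d_def using pi by (intro zero_less_power) linarith
  have mono: "c / d \<le> c / y\<^sup>2" if "\<bar>y\<bar> \<le> \<bar>x\<bar> + pi / 2" "y \<noteq> 0" "0 \<le> c" for c y :: real
  proof -
    have "y\<^sup>2 \<le> d" unfolding d_def using that by (metis abs_ge_zero power2_abs power_mono)
    then show ?thesis using that dpos by (intro divide_left_mono) auto
  qed
  have "2 * (1 - sin x) / d \<le> fejer (x - pi / 2)"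
  proof (cases "x = pi / 2")
    case False
    have "2 * (1 - sin x) / d \<le> 2 * (1 - sin x) / (x - pi / 2)\<^sup>2"
      using False pi by (intro mono) (auto simp: abs_if)
    also have "cos (x - pi / 2) = sin x" by (simp add: cos_diff)
    then have "2 * (1 - sin x) / (x - pi / 2)\<^sup>2 \<le> fejer (x - pi / 2)"
      using fejer_ge[of "x - pi / 2"] by simp
    finally show ?thesis .
  next
    \<comment> \<open>At the centre of the translate the numerator \<open>1 - sin x\<close>
      vanishes, so nonnegativity of the kernel suffices.\<close>
    case True
    then have "sin x = 1" by (metis sin_pi_half)
    then show ?thesis by (simp add: fejer_nonneg)
  qed
  moreover have "2 * (1 + sin x) / d \<le> fejer (x + pi / 2)"
  proof (cases "x = - pi / 2")
    case False
    have "2 * (1 + sin x) / d \<le> 2 * (1 + sin x) / (x + pi / 2)\<^sup>2"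
      using False pi sin_ge_minus_one[of x] by (intro mono; (linarith | argo))
    also have "cos (x + pi / 2) = - sin x" by (simp add: cos_add)
    then have "2 * (1 + sin x) / (x + pi / 2)\<^sup>2 \<le> fejer (x + pi / 2)"
      using fejer_ge[of "x + pi / 2"] by simp
    finally show ?thesis .
  next
    case True
    then have "sin x = - 1" by (metis sin_minus sin_pi_half minus_divide_left)
    then show ?thesis by (simp add: fejer_nonneg)
  qed
  ultimately have "4 / d \<le> fejer (x - pi / 2) + fejer (x + pi / 2)"
    by (simp add: add_divide_distrib diff_divide_distrib)
  \<comment> \<open>Together with the lower bound \<open>4 / d\<close> this yields
    \<open>1 / (2 * (1 + x^2))\<close>, whence the factor 2 in the claim.\<close>
  moreover have "d \<le> 8 * (1 + x\<^sup>2)"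
  proof -
    have "d \<le> (\<bar>x\<bar> + 2)\<^sup>2" unfolding d_def using pi by (intro power_mono) auto
    also have "\<dots> = x\<^sup>2 + 4 * \<bar>x\<bar> + 4"
      by (simp add: power2_eq_square algebra_simps)
    also have "\<dots> \<le> 8 * (1 + x\<^sup>2)"
    proof -
      have "2 * \<bar>x\<bar> \<le> 1 + x\<^sup>2"
        using zero_le_power2[of "\<bar>x\<bar> - 1"] by (simp add: power2_eq_square algebra_simps)
      then show ?thesis using zero_le_power2[of x] by argo
    qed
    finally show ?thesis .
  qed
  moreover have "1 / (1 + x\<^sup>2) \<le> 8 / d"
    using dpos \<open>d \<le> 8 * (1 + x\<^sup>2)\<close> by (simp add: divide_simps add_pos_nonneg)
  ultimately show ?thesis by (simp add: field_simps)
qed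

text \<open>Fubini, applied to the integral that defines \<open>fejer\<close>. Since
  \<open>tri\<close> vanishes outside \<open>{-1..1}\<close>, the right side sees the law of
  \<open>Y\<close> only through frequencies of modulus at most 1.\<close>

lemma (in prob_space) expectation_fejer:
  assumes [measurable]: "Y \<in> borel_measurable M"
  shows "expectation (\<lambda>\<omega>. fejer (Y \<omega>)) = (LBINT t. tri t * expectation (\<lambda>\<omega>. cos (t * Y \<omega>)))"
proof -
  interpret P: pair_sigma_finite M lborel ..
  have "integrable (M \<Otimes>\<^sub>M lborel) (\<lambda>(\<omega>, t). tri t * cos (t * Y \<omega>))"
  proof (rule integrableI_bounded_set[where A = "space M \<times> {-1..1}" and B = 1])
    show "emeasure (M \<Otimes>\<^sub>M lborel) (space M \<times> {- 1..1::real}) < \<infinity>"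
      by (subst lborel.emeasure_pair_measure_Times) (auto simp: emeasure_space_1)
    show "AE x\<in>space M \<times> {- 1..1} in M \<Otimes>\<^sub>M lborel. norm (case x of (\<omega>, t) \<Rightarrow> tri t * cos (t * Y \<omega>)) \<le> 1"
      using tri_nonneg tri_le_1 by (auto simp: abs_mult split_beta intro!: mult_le_one)
    show "AE x in M \<Otimes>\<^sub>M lborel. x \<notin> space M \<times> {- 1..1} \<longrightarrow> (case x of (\<omega>, t) \<Rightarrow> tri t * cos (t * Y \<omega>)) = 0"
      by (rule AE_I2) (auto simp: tri_def space_pair_measure)
  qed auto
  from P.Fubini_integral[OF this] show ?thesis
    unfolding fejer_def by simp
qed

lemma integral_exp_neg_sq:
  assumes "0 < (v::real)"
  shows "integrable lborel (\<lambda>t. exp (- v * t\<^sup>2))" "(LBINT t. exp (- v * t\<^sup>2)) = sqrt (pi / v)"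
proof -
  define s where "s = sqrt (1 / (2 * v))"
  have s: "s > 0" "s\<^sup>2 = 1 / (2 * v)" using assms by (auto simp: s_def)
  have eq: "exp (- v * t\<^sup>2) = sqrt (pi / v) * normal_density 0 s t" for t
    using assms s by (simp add: normal_density_def real_sqrt_divide)
  show "integrable lborel (\<lambda>t. exp (- v * t\<^sup>2))"
    unfolding eq using s by (intro integrable_mult_right) (simp add: integrable_normal_density)
  show "(LBINT t. exp (- v * t\<^sup>2)) = sqrt (pi / v)"
    unfolding eq using s by (simp add: integral_normal_density)
qed

subsection \<open>Local limit bounds for sums of independent variables\<close>

text \<open>Meant for the tilted law, whose mean is \<open>b\<close>. The third absolute moment
  gives an explicit error in the second-order expansion of the characteristic function;
  \<open>nondeg\<close> makes the variance positive and still admits lattice laws.\<close>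

locale nondegenerate_law = real_distribution G for G :: "real measure" +
  fixes b :: real
  assumes int3: "integrable G (\<lambda>x. \<bar>x - b\<bar> ^ 3)"
    and mean: "expectation (\<lambda>x. x - b) = 0"
    and nondeg: "\<not> (AE x in G. x = b)"
begin

section \<open>The centred characteristic function near the origin\<close>

definition cf :: "real \<Rightarrow> complex" where
  "cf t = (CLINT x|G. iexp (t * (x - b)))"

definition var :: real where
  "var = expectation (\<lambda>x. (x - b)\<^sup>2)"

text \<open>The divisor 6 is the \<open>3!\<close> of the Taylor remainder, so that
  \<open>third\<close> is itself the constant in \<open>cf_approx\<close>.\<close>

definition third :: real where
  "third = expectation (\<lambda>x. \<bar>x - b\<bar> ^ 3) / 6"

lemma third_nonneg: "0 \<le> third"
  by (simp add: third_def)

lemma integrable_centred_power: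
  assumes "k \<le> 3"
  shows "integrable G (\<lambda>x. (x - b) ^ k)"
proof (rule Bochner_Integration.integrable_bound)
  show "integrable G (\<lambda>x. 1 + \<bar>x - b\<bar> ^ 3)" using int3 by simp
  show "AE x in G. norm ((x - b) ^ k) \<le> norm (1 + \<bar>x - b\<bar> ^ 3)"
  proof (rule AE_I2)
    fix x
    have "\<bar>x - b\<bar> ^ k \<le> 1 + \<bar>x - b\<bar> ^ 3"
    proof (cases "\<bar>x - b\<bar> \<le> 1")
      case True
      then have "\<bar>x - b\<bar> ^ k \<le> 1" by (simp add: power_le_one)
      then show ?thesis by (smt (verit) zero_le_power abs_ge_zero)
    next
      case False
      then have "\<bar>x - b\<bar> ^ k \<le> \<bar>x - b\<bar> ^ 3" using assms by (intro power_increasing) auto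
      then show ?thesis by simp
    qed
    then show "norm ((x - b) ^ k) \<le> norm (1 + \<bar>x - b\<bar> ^ 3)"
      by (simp add: power_abs)
  qed
qed simp

lemma var_pos: "0 < var"
proof -
  have "var \<noteq> 0"
  proof
    assume "var = 0"
    then have "AE x in G. (x - b)\<^sup>2 = 0"
      unfolding var_def
      using integrable_centred_power[of 2] by (subst (asm) integral_nonneg_eq_0_iff_AE) auto
    then show False using nondeg by simp
  qed
  moreover have "0 \<le> var" unfolding var_def by (simp add: integral_nonneg_AE)
  ultimately show ?thesis by simp
qed

lemma cf_char: "cf = char (distr G borel (\<lambda>x. x - b))"
  by (rule ext) (simp add: cf_def char_def integral_distr)

lemma norm_cf_le_1: "norm (cf t) \<le> 1"
proof -
  interpret D: real_distribution "distr G borel (\<lambda>x. x - b)" by (rule real_distribution_distr) simp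
  show ?thesis unfolding cf_char by (rule D.cmod_char_le_1)
qed

lemma cf_measurable [measurable]: "cf \<in> borel_measurable borel"
proof -
  interpret D: real_distribution "distr G borel (\<lambda>x. x - b)" by (rule real_distribution_distr) simp
  show ?thesis unfolding cf_char by (rule D.char_measurable)
qed

text \<open>The general Taylor estimate has the minimum of a quadratic and a cubic term under the
  expectation. The third moment allows keeping the cubic one, which gives a rate and not merely
  \<open>o(t^2)\<close>.\<close>

lemma cf_approx: "norm (cf t - of_real (1 - t\<^sup>2 * var / 2)) \<le> third * \<bar>t\<bar> ^ 3"
proof -
  have "norm (cf t - of_real (1 - t\<^sup>2 * var / 2))
      \<le> (t\<^sup>2 / 6) * expectation (\<lambda>x. min (6 * (x - b)\<^sup>2) (\<bar>t\<bar> * \<bar>x - b\<bar> ^ 3))"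
    using char_approx3'[where X = "\<lambda>x. x - b" and t = t, OF _ _ _ mean _ refl]
      integrable_centred_power[of 1] integrable_centred_power[of 2] mean
    by (simp add: var_def cf_char)
  also have "\<dots> \<le> (t\<^sup>2 / 6) * expectation (\<lambda>x. \<bar>t\<bar> * \<bar>x - b\<bar> ^ 3)"
    using int3 by (intro mult_left_mono integral_mono integrable_min integrable_mult_right integrable_centred_power) auto
  also have "\<dots> = third * \<bar>t\<bar> ^ 3"
    by (simp add: third_def power3_eq_cube power2_eq_square abs_mult[symmetric])
  finally show ?thesis by simp
qed

text \<open>Close to 0 the cubic error eats at most half of the quadratic term
  \<open>t^2 * var / 2\<close>, and \<open>1 + z \<le> exp z\<close> turns what is left into a
  Gaussian bound.\<close>

lemma cf_decay:
  obtains R0 where "1 \<le> R0" "\<And>t. \<bar>t\<bar> \<le> 1 / R0 \<Longrightarrow> norm (cf t) \<le> exp (- (var / 4) * t\<^sup>2)"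
proof
  \<comment> \<open>For \<open>\<bar>t\<bar> * R0 \<le> 1\<close> the three summands give, in this
    order, \<open>\<bar>t\<bar> \<le> 1\<close>, \<open>third * \<bar>t\<bar> \<le> var / 4\<close>
    and \<open>\<bar>t\<bar> * var \<le> 1\<close>. The first and last make
    \<open>1 - t^2 * var / 2\<close> nonnegative, so its norm is itself.\<close>
  define R0 where "R0 = 1 + 4 * third / var + var"
  note v = var_pos and th = third_nonneg
  show R1: "1 \<le> R0" unfolding R0_def using v th by simp
  fix t :: real
  assume t: "\<bar>t\<bar> \<le> 1 / R0"
  then have t1: "\<bar>t\<bar> \<le> 1" using R1 by (smt (verit) divide_le_eq_1_pos)
  have tR: "\<bar>t\<bar> * R0 \<le> 1" using t R1 by (simp add: field_simps)
  have "\<bar>t\<bar> * (4 * third / var) \<le> \<bar>t\<bar> * R0" "\<bar>t\<bar> * var \<le> \<bar>t\<bar> * R0"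
    unfolding R0_def using v th by (intro mult_left_mono; simp)+
  with tR have a: "\<bar>t\<bar> * (4 * third / var) \<le> 1" and bb: "\<bar>t\<bar> * var \<le> 1" by auto
  have a': "third * \<bar>t\<bar> \<le> var / 4" using a v by (simp add: field_simps)
  have "\<bar>t\<bar> * (\<bar>t\<bar> * var) \<le> 1 * 1" using t1 bb v by (intro mult_mono) auto
  then have b': "t\<^sup>2 * var \<le> 1" by (simp add: power2_eq_square mult.assoc[symmetric])
  have "norm (cf t) \<le> norm (of_real (1 - t\<^sup>2 * var / 2) :: complex) + third * \<bar>t\<bar> ^ 3"
    using cf_approx[of t] norm_triangle_sub[of "cf t" "of_real (1 - t\<^sup>2 * var / 2)"] by linarith
  also have "norm (of_real (1 - t\<^sup>2 * var / 2) :: complex) = 1 - t\<^sup>2 * var / 2"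
    using b' by (subst norm_of_real) simp
  also have "third * \<bar>t\<bar> ^ 3 = (third * \<bar>t\<bar>) * t\<^sup>2"
    by (simp add: power3_eq_cube power2_eq_square abs_mult[symmetric] mult.assoc)
  also have "\<dots> \<le> var / 4 * t\<^sup>2" using a' by (intro mult_right_mono) auto
  finally have "norm (cf t) \<le> 1 + (- (var / 4) * t\<^sup>2)" by (simp add: algebra_simps)
  also have "\<dots> \<le> exp (- (var / 4) * t\<^sup>2)" by (rule exp_ge_add_one_self)
  finally show "norm (cf t) \<le> exp (- (var / 4) * t\<^sup>2)" .
qed

section \<open>Sums over finite index sets: Fourier integrals, concentration and the local
  limit\<close>

lemma prob_space_sample: "prob_space (PiM I (\<lambda>_. G))"
  by (intro prob_space_PiM prob_space_axioms)

text \<open>Independence factors the integral. The index set is any finite set, and not just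
  \<open>{..<n}\<close>, because the big-jump estimate removes one index.\<close>

lemma integral_iexp_sum:
  assumes "finite I"
  shows "(CLINT x|PiM I (\<lambda>_. G). iexp (t * ((\<Sum>i\<in>I. x i) - a)))
    = iexp (t * (card I * b - a)) * cf t ^ card I"
proof -
  interpret P: product_sigma_finite "\<lambda>_. G" by unfold_locales
  have "(CLINT x|PiM I (\<lambda>_. G). iexp (t * ((\<Sum>i\<in>I. x i) - a)))
      = (CLINT x|PiM I (\<lambda>_. G). iexp (t * (card I * b - a)) * (\<Prod>i\<in>I. iexp (t * (x i - b))))"
  proof (rule Bochner_Integration.integral_cong)
    fix x :: "'a \<Rightarrow> real"
    have "t * ((\<Sum>i\<in>I. x i) - a) = t * (card I * b - a) + (\<Sum>i\<in>I. t * (x i - b))"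
      by (simp add: sum_distrib_left[symmetric] sum_subtractf algebra_simps)
    then show "iexp (t * ((\<Sum>i\<in>I. x i) - a)) = iexp (t * (card I * b - a)) * (\<Prod>i\<in>I. iexp (t * (x i - b)))"
      using assms by (simp only: of_real_add of_real_sum distrib_left exp_add sum_distrib_left exp_sum)
  qed simp
  also have "\<dots> = iexp (t * (card I * b - a)) * (CLINT x|PiM I (\<lambda>_. G). (\<Prod>i\<in>I. iexp (t * (x i - b))))"
    by simp
  also have "(CLINT x|PiM I (\<lambda>_. G). (\<Prod>i\<in>I. iexp (t * (x i - b)))) = (\<Prod>i\<in>I. cf t)"
    unfolding cf_def
    by (rule P.product_integral_prod[OF assms]) (rule integrable_iexp, auto)
  finally show ?thesis by simp
qed

text \<open>Stretching the kernel by \<open>R\<close> narrows the frequency window: only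
  \<open>cf\<close> on \<open>{-1/R..1/R}\<close> enters. For \<open>R \<ge> R0\<close> this lies
  inside the region where \<open>cf_decay\<close> applies.\<close>

lemma expectation_fejer_sum:
  assumes "finite I" "0 < R"
  shows "integral\<^sup>L (PiM I (\<lambda>_. G)) (\<lambda>x. fejer (((\<Sum>i\<in>I. x i) - a) / R))
    = (LBINT t. tri t * Re (iexp (t / R * (card I * b - a)) * cf (t / R) ^ card I))"
proof -
  interpret P: prob_space "PiM I (\<lambda>_. G)" by (rule prob_space_sample)
  have *: "P.expectation (\<lambda>x. cos (t * (((\<Sum>i\<in>I. x i) - a) / R)))
      = Re (iexp (t / R * (card I * b - a)) * cf (t / R) ^ card I)" for t
  proof -
    have "P.expectation (\<lambda>x. cos (t * (((\<Sum>i\<in>I. x i) - a) / R)))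
       = P.expectation (\<lambda>x. Re (iexp (t / R * ((\<Sum>i\<in>I. x i) - a))))"
      by (simp add: Re_exp)
    also have "\<dots> = Re (CLINT x|PiM I (\<lambda>_. G). iexp (t / R * ((\<Sum>i\<in>I. x i) - a)))"
      by (rule integral_Re, rule P.integrable_iexp) auto
    finally show ?thesis by (simp only: integral_iexp_sum[OF assms(1)])
  qed
  show ?thesis
    by (subst P.expectation_fejer) (simp_all only: *, simp)
qed

lemma norm_weighted_cf_le: "\<bar>tri t * Re (iexp y * cf s ^ n)\<bar> \<le> tri t * norm (cf s) ^ n"
proof -
  have "\<bar>Re (iexp y * cf s ^ n)\<bar> \<le> norm (cf s) ^ n"
    using abs_Re_le_cmod[of "iexp y * cf s ^ n"] by (simp add: norm_mult norm_power)
  then show ?thesis by (simp add: abs_mult tri_nonneg mult_left_mono)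
qed

text \<open>A smooth form of Esseen's concentration inequality: the Cauchy weight stands in for the
  indicator of an interval of length of order \<open>R\<close> around \<open>a\<close>. It is
  dominated by two Fejer translates, and \<open>cf_decay\<close> bounds each of their Fourier
  integrals by a Gaussian integral. Taking norms discards the phase, hence the uniformity in
  \<open>a\<close>.\<close>

lemma concentration:
  obtains C R0 where "1 \<le> R0" "0 < C"
    "\<And>(I :: nat set) R a. finite I \<Longrightarrow> I \<noteq> {} \<Longrightarrow> R0 \<le> R \<Longrightarrow>
      integral\<^sup>L (PiM I (\<lambda>_. G)) (\<lambda>x. 1 / (1 + (((\<Sum>i\<in>I. x i) - a) / R)\<^sup>2)) \<le> C * R / sqrt (card I)"
proof -
  obtain R0 where R0: "1 \<le> R0" "\<And>t. \<bar>t\<bar> \<le> 1 / R0 \<Longrightarrow> norm (cf t) \<le> exp (- (var / 4) * t\<^sup>2)"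
    by (rule cf_decay) blast
  \<comment> \<open>The 4 is the factor 2 of \<open>cauchy_le_fejer\<close> times two translates;
    the root is that of the Gaussian integral \<open>sqrt (pi / v)\<close> with
    \<open>R / sqrt n\<close> taken out.\<close>
  define C where "C = 4 * sqrt (4 * pi / var)"
  show thesis
  proof (rule that[of R0 C])
    show "1 \<le> R0" by fact
    show "0 < C" unfolding C_def using var_pos by simp
    fix I :: "nat set" and R a :: real
    assume I: "finite I" "I \<noteq> {}" and R: "R0 \<le> R"
    have Rpos: "0 < R" using R R0(1) by simp
    define n where "n = card I"
    have n: "0 < n" using I by (simp add: n_def card_gt_0_iff)
    interpret P: prob_space "PiM I (\<lambda>_. G)" by (rule prob_space_sample)
    define v where "v = var / 4 * n / R\<^sup>2"
    have v: "0 < v" unfolding v_def using var_pos n Rpos by simp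
    have fej: "P.expectation (\<lambda>x. fejer (((\<Sum>i\<in>I. x i) - a) / R)) \<le> sqrt (4 * pi / var) * R / sqrt n" for a
    proof -
      have "P.expectation (\<lambda>x. fejer (((\<Sum>i\<in>I. x i) - a) / R))
        = (LBINT t. tri t * Re (iexp (t / R * (n * b - a)) * cf (t / R) ^ n))"
        unfolding n_def by (rule expectation_fejer_sum[OF I(1) Rpos])
      also have "\<dots> \<le> (LBINT t. exp (- v * t\<^sup>2))"
      proof (rule integral_mono_AE)
        show "integrable lborel (\<lambda>t. exp (- v * t\<^sup>2))" by (rule integral_exp_neg_sq(1)[OF v])
        show "integrable lborel (\<lambda>t. tri t * Re (iexp (t / R * (n * b - a)) * cf (t / R) ^ n))"
        proof (rule integrable_tri_times)
          show "norm (Re (iexp (t / R * (n * b - a)) * cf (t / R) ^ n)) \<le> 1" for t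
          proof -
            have "norm (Re (iexp (t / R * (n * b - a)) * cf (t / R) ^ n)) \<le> norm (cf (t / R)) ^ n"
              using abs_Re_le_cmod[of "iexp (t / R * (n * b - a)) * cf (t / R) ^ n"]
              by (simp only: real_norm_def norm_mult norm_power norm_exp_i_times)
            also have "\<dots> \<le> 1" by (intro power_le_one norm_cf_le_1) auto
            finally show ?thesis .
          qed
        qed simp
        show "AE t in lborel. tri t * Re (iexp (t / R * (n * b - a)) * cf (t / R) ^ n) \<le> exp (- v * t\<^sup>2)"
        proof (rule AE_I2)
          fix t :: real
          show "tri t * Re (iexp (t / R * (n * b - a)) * cf (t / R) ^ n) \<le> exp (- v * t\<^sup>2)"
          proof (cases "\<bar>t\<bar> \<le> 1")
            case True
            have "\<bar>t / R\<bar> \<le> 1 / R0"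
              using True R R0(1) by (auto simp: abs_divide intro!: frac_le)
            from R0(2)[OF this] have "norm (cf (t / R)) ^ n \<le> exp (- (var / 4) * (t / R)\<^sup>2) ^ n"
              by (intro power_mono) auto
            also have "\<dots> = exp (- v * t\<^sup>2)"
              by (simp add: exp_of_nat_mult[symmetric] v_def power_divide field_simps)
            finally have *: "norm (cf (t / R)) ^ n \<le> exp (- v * t\<^sup>2)" .
            have "tri t * Re (iexp (t / R * (n * b - a)) * cf (t / R) ^ n) \<le> tri t * norm (cf (t / R)) ^ n"
              using norm_weighted_cf_le[of t "t / R * (n * b - a)" "t / R" n] by simp
            also have "\<dots> \<le> 1 * exp (- v * t\<^sup>2)"
              using * by (intro mult_mono tri_le_1) auto
            finally show ?thesis by simp
          qed (simp add: tri_eq_0)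
        qed
      qed
      also have "\<dots> = sqrt (4 * pi / var) * R / sqrt n"
        unfolding integral_exp_neg_sq(2)[OF v] using Rpos
        by (simp add: v_def real_sqrt_divide real_sqrt_mult)
      finally show ?thesis .
    qed
    have int: "integrable (PiM I (\<lambda>_. G)) (\<lambda>x. fejer (((\<Sum>i\<in>I. x i) - a) / R))" for a
      by (rule P.integrable_const_bound[where B = 1]) (auto simp: fejer_nonneg fejer_le_1)
    define S where "S = (\<lambda>x. \<Sum>i\<in>I. x i :: real)"
    have [measurable]: "S \<in> borel_measurable (PiM I (\<lambda>_. G))" unfolding S_def by measurable
    have eq: "(S x - a) / R - pi / 2 = (S x - (a + R * pi / 2)) / R"
       "(S x - a) / R + pi / 2 = (S x - (a - R * pi / 2)) / R" for x
      using Rpos by (auto simp: field_simps)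
    have "P.expectation (\<lambda>x. 1 / (1 + ((S x - a) / R)\<^sup>2))
      \<le> P.expectation (\<lambda>x. 2 * (fejer ((S x - (a + R * pi / 2)) / R) + fejer ((S x - (a - R * pi / 2)) / R)))"
    proof (rule integral_mono)
      show "integrable (PiM I (\<lambda>_. G)) (\<lambda>x. 1 / (1 + ((S x - a) / R)\<^sup>2))"
        by (rule P.integrable_const_bound[where B = 1]) (auto simp: add_pos_nonneg divide_le_eq)
      show "1 / (1 + ((S x - a) / R)\<^sup>2)
        \<le> 2 * (fejer ((S x - (a + R * pi / 2)) / R) + fejer ((S x - (a - R * pi / 2)) / R))" for x
        using cauchy_le_fejer[of "(S x - a) / R"] by (simp only: eq)
    qed (use int in \<open>auto simp: S_def intro!: integrable_mult_right Bochner_Integration.integrable_add\<close>)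
    also have "\<dots> = 2 * (P.expectation (\<lambda>x. fejer ((S x - (a + R * pi / 2)) / R))
          + P.expectation (\<lambda>x. fejer ((S x - (a - R * pi / 2)) / R)))"
      using int by (simp add: S_def)
    also have "\<dots> \<le> 2 * (sqrt (4 * pi / var) * R / sqrt n + sqrt (4 * pi / var) * R / sqrt n)"
      unfolding S_def by (intro mult_left_mono add_mono fej) auto
    also have "\<dots> = C * R / sqrt (card I)" by (simp add: C_def n_def)
    finally show "P.expectation (\<lambda>x. 1 / (1 + (((\<Sum>i\<in>I. x i) - a) / R)\<^sup>2)) \<le> C * R / sqrt (card I)"
      by (simp add: S_def)
  qed
qed

text \<open>The central limit theorem at the level of transforms. For bases in the unit disc,
  \<open>n\<close>-th powers differ by at most \<open>n\<close> times the difference of the bases,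
  and \<open>cf_approx\<close> makes this of order \<open>1 / sqrt n\<close>.\<close>

lemma cf_power_tendsto: "(\<lambda>n. cf (t / sqrt n) ^ n) \<longlonglongrightarrow> of_real (exp (- (t\<^sup>2 * var / 2)))"
proof -
  let ?w = "\<lambda>n::nat. complex_of_real (1 + (- (t\<^sup>2 * var / 2)) / n)"
  have main: "\<forall>\<^sub>F n in sequentially. norm (cf (t / sqrt n) ^ n - ?w n ^ n) \<le> third * \<bar>t\<bar> ^ 3 / sqrt n"
  proof (rule eventually_sequentiallyI)
    fix n :: nat
    \<comment> \<open>This threshold keeps \<open>?w n\<close> in the unit disc, as
      \<open>norm_power_diff\<close> requires.\<close>
    assume n: "n \<ge> nat \<lceil>t\<^sup>2 * var\<rceil> + 1"
    then have n0: "0 < n" by simp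
    have "t\<^sup>2 * var \<le> n" using n by linarith
    then have w1: "norm (?w n) \<le> 1"
      using n0 var_pos by (subst norm_of_real) (auto simp: abs_le_iff field_simps)
    have "norm (cf (t / sqrt n) ^ n - ?w n ^ n) \<le> n * norm (cf (t / sqrt n) - ?w n)"
      by (intro norm_power_diff norm_cf_le_1 w1)
    also have "n * norm (cf (t / sqrt n) - ?w n)
        = n * norm (cf (t / sqrt n) - of_real (1 - (t / sqrt n)\<^sup>2 * var / 2))"
      using n0 by (simp add: power_divide mult.commute)
    also have "\<dots> \<le> n * (third * \<bar>t / sqrt n\<bar> ^ 3)"
      by (intro mult_left_mono cf_approx) auto
    also have "\<dots> = third * \<bar>t\<bar> ^ 3 / sqrt n"
      using n0 by (simp add: abs_divide power_divide power3_eq_cube)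
    finally show "norm (cf (t / sqrt n) ^ n - ?w n ^ n) \<le> third * \<bar>t\<bar> ^ 3 / sqrt n" .
  qed
  have "(\<lambda>n::nat. third * \<bar>t\<bar> ^ 3 / sqrt n) \<longlonglongrightarrow> 0"
    by (intro tendsto_divide_0[OF tendsto_const] filterlim_at_top_imp_at_infinity
          filterlim_compose[OF sqrt_at_top] filterlim_real_sequentially)
  from Lim_null_comparison[OF main this]
  have d: "(\<lambda>n. cf (t / sqrt n) ^ n - ?w n ^ n) \<longlonglongrightarrow> 0" .
  have "(\<lambda>n. complex_of_real ((1 + (- (t\<^sup>2 * var / 2)) / n) ^ n)) \<longlonglongrightarrow> of_real (exp (- (t\<^sup>2 * var / 2)))"
    by (intro tendsto_of_real tendsto_exp_limit_sequentially)
  then have "(\<lambda>n. ?w n ^ n) \<longlonglongrightarrow> of_real (exp (- (t\<^sup>2 * var / 2)))" by simp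
  from tendsto_add[OF d this] show ?thesis by simp
qed

text \<open>Substituting \<open>t = s / sqrt n\<close> absorbs the factor \<open>sqrt n\<close>, and
  dominated convergence leads to a Gaussian integral. For fixed \<open>a\<close> the phase tends to
  1, which is why the limit \<open>c\<close> does not depend on \<open>a\<close>.\<close>

lemma local_limit_fejer:
  obtains R0 c where "1 \<le> R0" "0 < c"
    "\<And>a. (\<lambda>n::nat. sqrt n * (LBINT t. tri t * Re (iexp (t / R0 * a) * cf (t / R0) ^ n))) \<longlonglongrightarrow> c"
proof -
  obtain R0 where R0: "1 \<le> R0" "\<And>t. \<bar>t\<bar> \<le> 1 / R0 \<Longrightarrow> norm (cf t) \<le> exp (- (var / 4) * t\<^sup>2)"
    by (rule cf_decay) blast
  define v where "v = var / 2 / R0\<^sup>2"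
  have v: "0 < v" unfolding v_def using var_pos R0(1) by simp
  define c where "c = sqrt (pi / v)"
  show thesis
  proof (rule that[of R0 c])
    show "1 \<le> R0" by fact
    show "0 < c" using v by (simp add: c_def)
    fix a :: real
    define f where "f n t = tri t * Re (iexp (t / R0 * a) * cf (t / R0) ^ n)" for n t
    define g where "g n s = f n (s / sqrt n)" for n :: nat and s
    have [measurable]: "f n \<in> borel_measurable borel" for n
      unfolding f_def by measurable
    have scale: "sqrt n * (LBINT t. f n t) = (LBINT s. g n s)" if "0 < n" for n :: nat
      using lborel_integral_real_affine[of "1 / sqrt n" "f n" 0] that by (simp add: g_def)
    \<comment> \<open>The index is shifted because at \<open>n = 0\<close> division by
      \<open>sqrt 0\<close> makes \<open>g 0 s = 1\<close> for all \<open>s\<close>, which is not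
      integrable. The dominating exponent is half the limiting one, since \<open>cf_decay\<close>
      retains half of the variance term.\<close>
    have "(\<lambda>n. LBINT s. g (Suc n) s) \<longlonglongrightarrow> (LBINT s. exp (- v * s\<^sup>2))"
    proof (rule integral_dominated_convergence[where w = "\<lambda>s. exp (- (v / 2) * s\<^sup>2)"])
      show "integrable lborel (\<lambda>s. exp (- (v / 2) * s\<^sup>2))"
        using v by (intro integral_exp_neg_sq(1)) simp
      show "AE s in lborel. norm (g (Suc n) s) \<le> exp (- (v / 2) * s\<^sup>2)" for n
      proof (rule AE_I2)
        fix s :: real
        let ?t = "s / sqrt (Suc n)"
        show "norm (g (Suc n) s) \<le> exp (- (v / 2) * s\<^sup>2)"
        proof (cases "\<bar>?t\<bar> \<le> 1")
          case True
          then have "\<bar>?t / R0\<bar> \<le> 1 / R0" using R0(1) divide_right_mono[of "\<bar>?t\<bar>" 1 R0] by (simp add: abs_divide)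
          from R0(2)[OF this] have "norm (cf (?t / R0)) ^ Suc n \<le> exp (- (var / 4) * (?t / R0)\<^sup>2) ^ Suc n"
            by (intro power_mono) auto
          also have "\<dots> = exp (of_nat (Suc n) * (- (var / 4) * (?t / R0)\<^sup>2))"
            by (simp only: exp_of_nat_mult)
          also have "of_nat (Suc n) * (- (var / 4) * (?t / R0)\<^sup>2) = - (v / 2) * s\<^sup>2"
            by (simp add: v_def power_divide power_mult_distrib del: of_nat_Suc)
          finally have *: "norm (cf (?t / R0)) ^ Suc n \<le> exp (- (v / 2) * s\<^sup>2)" .
          have "norm (g (Suc n) s) \<le> tri ?t * norm (cf (?t / R0)) ^ Suc n"
            unfolding g_def f_def real_norm_def by (rule norm_weighted_cf_le)
          also have "\<dots> \<le> 1 * exp (- (v / 2) * s\<^sup>2)"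
            using * by (intro mult_mono tri_le_1) auto
          finally show ?thesis by simp
        qed (simp add: g_def f_def tri_eq_0)
      qed
      show "AE s in lborel. (\<lambda>n. g (Suc n) s) \<longlonglongrightarrow> exp (- v * s\<^sup>2)"
      proof (rule AE_I2)
        fix s :: real
        have z: "(\<lambda>n::nat. s / sqrt n) \<longlonglongrightarrow> 0"
          by (intro tendsto_divide_0[OF tendsto_const] filterlim_at_top_imp_at_infinity
            filterlim_compose[OF sqrt_at_top] filterlim_real_sequentially)
        have t1: "(\<lambda>n::nat. tri (s / sqrt n)) \<longlonglongrightarrow> tri 0"
          using continuous_on_tri[of UNIV] z by (intro isCont_tendsto_compose[of _ tri]) (auto simp: continuous_on_eq_continuous_at)
        have t2: "(\<lambda>n::nat. iexp (s / sqrt n / R0 * a)) \<longlonglongrightarrow> iexp (0 / R0 * a)"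
          using R0(1) by (intro tendsto_intros z) auto
        have t3: "(\<lambda>n::nat. cf (s / sqrt n / R0) ^ n) \<longlonglongrightarrow> of_real (exp (- v * s\<^sup>2))"
          using cf_power_tendsto[of "s / R0"] by (simp add: v_def power_divide mult.commute)
        have "(\<lambda>n::nat. g n s) \<longlonglongrightarrow> tri 0 * Re (iexp (0 / R0 * a) * of_real (exp (- v * s\<^sup>2)))"
          unfolding g_def f_def by (intro tendsto_mult tendsto_Re t1 t2 t3)
        then have "(\<lambda>n::nat. g n s) \<longlonglongrightarrow> exp (- v * s\<^sup>2)" by (simp add: tri_def)
        then show "(\<lambda>n. g (Suc n) s) \<longlonglongrightarrow> exp (- v * s\<^sup>2)" by (rule LIMSEQ_Suc)
      qed
    qed (auto simp: g_def)
    then have "(\<lambda>n. sqrt (Suc n) * (LBINT t. f (Suc n) t)) \<longlonglongrightarrow> c"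
      unfolding integral_exp_neg_sq(2)[OF v] c_def by (subst scale) auto
    then show "(\<lambda>n::nat. sqrt n * (LBINT t. tri t * Re (iexp (t / R0 * a) * cf (t / R0) ^ n))) \<longlonglongrightarrow> c"
      unfolding f_def by (rule LIMSEQ_imp_Suc)
  qed
qed

text \<open>After tilting, a one-sided exponential weight is left on the tail event. On positive
  arguments it is at most a multiple of the Cauchy weight, so \<open>concentration\<close> supplies
  the order \<open>1 / sqrt n\<close>, uniformly in the level \<open>a\<close>.\<close>

lemma exp_tail_bound:
  assumes "0 < \<theta>"
  obtains C where "0 < C"
    "\<And>(I :: nat set) a. finite I \<Longrightarrow> I \<noteq> {} \<Longrightarrow>
      (\<integral>\<^sup>+x. ennreal (exp (- \<theta> * ((\<Sum>i\<in>I. x i) - a))) * indicator {a<..} (\<Sum>i\<in>I. x i) \<partial>PiM I (\<lambda>_. G))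
        \<le> ennreal (C / sqrt (card I))"
proof -
  obtain C R0 where R0: "1 \<le> R0" and C: "0 < C" and conc:
    "\<And>(I :: nat set) R a. finite I \<Longrightarrow> I \<noteq> {} \<Longrightarrow> R0 \<le> R \<Longrightarrow>
      integral\<^sup>L (PiM I (\<lambda>_. G)) (\<lambda>x. 1 / (1 + (((\<Sum>i\<in>I. x i) - a) / R)\<^sup>2)) \<le> C * R / sqrt (card I)"
    by (rule concentration) blast
  \<comment> \<open>Chosen to compare coefficients with the quadratic Taylor polynomial of
    \<open>exp (\<theta> * s)\<close>: the summand 1 covers the constant term and the other one the
    term \<open>(s / R0)^2\<close>.\<close>
  define D where "D = 1 + 2 / (\<theta>\<^sup>2 * R0\<^sup>2)"
  have D: "0 < D" unfolding D_def using assms R0 by (intro add_pos_nonneg) auto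
  have bound: "exp (- \<theta> * s) \<le> D * (1 / (1 + (s / R0)\<^sup>2))" if "0 < s" for s
  proof -
    have nz: "\<theta> \<noteq> 0" "R0 \<noteq> 0" using assms R0 by auto
    have "1 + (s / R0)\<^sup>2 = 1 + 2 / (\<theta>\<^sup>2 * R0\<^sup>2) * ((\<theta> * s)\<^sup>2 / 2)"
      using nz by (simp add: power_divide power_mult_distrib)
    also have "\<dots> \<le> D + D * (\<theta> * s + (\<theta> * s)\<^sup>2 / 2)"
    proof (intro add_mono mult_mono)
      show "1 \<le> D" "2 / (\<theta>\<^sup>2 * R0\<^sup>2) \<le> D" unfolding D_def by auto
    qed (use assms that D in auto)
    also have "\<dots> = D * (1 + \<theta> * s + (\<theta> * s)\<^sup>2 / 2)" by (simp add: algebra_simps)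
    also have "\<dots> \<le> D * exp (\<theta> * s)"
      using assms that D by (intro mult_left_mono exp_lower_Taylor_quadratic) auto
    finally have "1 + (s / R0)\<^sup>2 \<le> D * exp (\<theta> * s)" .
    moreover have "0 < 1 + (s / R0)\<^sup>2" by (simp add: add_pos_nonneg)
    ultimately show ?thesis by (simp add: exp_minus field_simps)
  qed
  show thesis
  proof (rule that[of "D * C * R0"])
    show "0 < D * C * R0" using D C R0 by simp
    fix I :: "nat set" and a :: real
    assume I: "finite I" "I \<noteq> {}"
    interpret P: prob_space "PiM I (\<lambda>_. G)" by (rule prob_space_sample)
    have int: "integrable (PiM I (\<lambda>_. G)) (\<lambda>x. D * (1 / (1 + (((\<Sum>i\<in>I. x i) - a) / R0)\<^sup>2)))"
      using D by (intro P.integrable_const_bound[where B = D]) (auto simp: add_pos_nonneg divide_le_eq)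
    have "(\<integral>\<^sup>+x. ennreal (exp (- \<theta> * ((\<Sum>i\<in>I. x i) - a))) * indicator {a<..} (\<Sum>i\<in>I. x i) \<partial>PiM I (\<lambda>_. G))
      \<le> (\<integral>\<^sup>+x. ennreal (D * (1 / (1 + (((\<Sum>i\<in>I. x i) - a) / R0)\<^sup>2))) \<partial>PiM I (\<lambda>_. G))"
      using bound by (intro nn_integral_mono) (auto simp: indicator_def intro!: ennreal_leI)
    also have "\<dots> = ennreal (P.expectation (\<lambda>x. D * (1 / (1 + (((\<Sum>i\<in>I. x i) - a) / R0)\<^sup>2))))"
      using D by (intro nn_integral_eq_integral int) (auto simp: add_pos_nonneg)
    also have "P.expectation (\<lambda>x. D * (1 / (1 + (((\<Sum>i\<in>I. x i) - a) / R0)\<^sup>2)))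
        = D * P.expectation (\<lambda>x. 1 / (1 + (((\<Sum>i\<in>I. x i) - a) / R0)\<^sup>2))"
      by (rule integral_mult_right_zero)
    also have "ennreal \<dots> \<le> ennreal (D * (C * R0 / sqrt (card I)))"
      using D by (intro ennreal_leI mult_left_mono conc[OF I order_refl]) simp
    also have "D * (C * R0 / sqrt (card I)) = D * C * R0 / sqrt (card I)" by simp
    finally show "(\<integral>\<^sup>+x. ennreal (exp (- \<theta> * ((\<Sum>i\<in>I. x i) - a))) * indicator {a<..} (\<Sum>i\<in>I. x i) \<partial>PiM I (\<lambda>_. G))
      \<le> ennreal (D * C * R0 / sqrt (card I))" .
  qed
qed

text \<open>The Fejer kernel has tails, but by the concentration bound at scale \<open>R\<close> they contribute only
  \<open>O (1 / (R * sqrt n))\<close>, which is a small part of the main term once \<open>R\<close> is large.\<close>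

lemma local_lower_bound:
  obtains R c where "0 < R" "0 < c"
    "\<forall>\<^sub>F n in sequentially. c / sqrt n \<le> measure (PiM {..<n::nat} (\<lambda>_. G))
        {x \<in> space (PiM {..<n} (\<lambda>_. G)). b * n < (\<Sum>i<n. x i) \<and> (\<Sum>i<n. x i) < b * n + R}"
proof -
  obtain C R1 where R1: "1 \<le> R1" and C: "0 < C" and conc:
    "\<And>(I :: nat set) R a. finite I \<Longrightarrow> I \<noteq> {} \<Longrightarrow> R1 \<le> R \<Longrightarrow>
      integral\<^sup>L (PiM I (\<lambda>_. G)) (\<lambda>x. 1 / (1 + (((\<Sum>i\<in>I. x i) - a) / R)\<^sup>2)) \<le> C * R / sqrt (card I)"
    by (rule concentration) blast
  obtain R0 c where R0: "1 \<le> R0" and c: "0 < c" and lim: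
    "\<And>a. (\<lambda>n::nat. sqrt n * (LBINT t. tri t * Re (iexp (t / R0 * a) * cf (t / R0) ^ n))) \<longlonglongrightarrow> c"
    by (rule local_limit_fejer) blast
  \<comment> \<open>The kernel tails cost at most \<open>8 * R0^2 * C / R\<close> over
    \<open>sqrt n\<close>. This \<open>R\<close> makes that at most \<open>c / 4\<close>, half of
    the \<open>c / 2\<close> that \<open>lim\<close> eventually guarantees; the summand
    \<open>R1\<close> makes \<open>conc\<close> applicable.\<close>
  define R where "R = R1 + 32 * R0\<^sup>2 * C / c"
  have R: "R1 \<le> R" "0 < R" unfolding R_def using R1 C c by (auto intro!: add_pos_nonneg)
  have Rc: "8 * R0\<^sup>2 * C / R \<le> c / 4"
  proof -
    have "32 * R0\<^sup>2 * C / c \<le> R" unfolding R_def using R1 by simp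
    then show ?thesis using R c by (simp add: field_simps)
  qed
  have fejer_bound: "fejer (s / R0) \<le> indicator {-R<..<R} s + 8 * R0\<^sup>2 / R\<^sup>2 * (1 / (1 + (s / R)\<^sup>2))" for s
  proof (cases "\<bar>s\<bar> < R")
    case True
    then show ?thesis using fejer_le_1[of "s / R0"] by (auto simp: indicator_def intro: order_trans)
  next
    case False
    then have s: "R \<le> \<bar>s\<bar>" "s \<noteq> 0" using R by auto
    \<comment> \<open>Gives \<open>R^2 + s^2 \<le> 2 * s^2\<close>, which exchanges the decay
      \<open>4 / (s / R0)^2\<close> for the Cauchy weight at scale \<open>R\<close>.\<close>
    have sq: "R\<^sup>2 \<le> s\<^sup>2" using power_mono[OF s(1), of 2] R by simp
    have "fejer (s / R0) \<le> 4 / (s / R0)\<^sup>2" using s R0 by (intro fejer_le) auto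
    also have "\<dots> = 8 * R0\<^sup>2 / (2 * s\<^sup>2)" using s by (simp add: power_divide)
    also have "\<dots> \<le> 8 * R0\<^sup>2 / (R\<^sup>2 + s\<^sup>2)"
      using sq R by (intro divide_left_mono) (auto intro!: mult_pos_pos add_pos_nonneg simp: s)
    also have "R\<^sup>2 + s\<^sup>2 = R\<^sup>2 * (1 + (s / R)\<^sup>2)"
      using R by (simp add: power_divide distrib_left)
    also have "8 * R0\<^sup>2 / (R\<^sup>2 * (1 + (s / R)\<^sup>2)) = 8 * R0\<^sup>2 / R\<^sup>2 * (1 / (1 + (s / R)\<^sup>2))"
      by simp
    finally show ?thesis by (simp add: indicator_def)
  qed
  show thesis
  proof (rule that[of "2 * R" "c / 4"])
    show "0 < 2 * R" "0 < c / 4" using R c by auto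
    have "\<forall>\<^sub>F n in sequentially. c / 2 < sqrt (real n) * (LBINT t. tri t * Re (iexp (t / R0 * - R) * cf (t / R0) ^ n))"
      using c by (intro order_tendstoD(1)[OF lim]) simp
    then show "\<forall>\<^sub>F n in sequentially. c / 4 / sqrt n \<le> measure (PiM {..<n::nat} (\<lambda>_. G))
        {x \<in> space (PiM {..<n} (\<lambda>_. G)). b * n < (\<Sum>i<n. x i) \<and> (\<Sum>i<n. x i) < b * n + 2 * R}"
      using eventually_gt_at_top[of 0]
    proof eventually_elim
      case (elim n)
      interpret P: prob_space "PiM {..<n} (\<lambda>_. G)" by (rule prob_space_sample)
      define S where "S = (\<lambda>x. \<Sum>i<n. x i :: real)"
      have [measurable]: "S \<in> borel_measurable (PiM {..<n} (\<lambda>_. G))" unfolding S_def by measurable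
      \<comment> \<open>Centring here puts the symmetric window of half-width \<open>R\<close> just
        above \<open>b * n\<close>. The phase then contains \<open>n * b - a = - R\<close>, which is
        constant in \<open>n\<close>, as \<open>lim\<close> demands.\<close>
      define a where "a = b * n + R"
      define E where "E = {x \<in> space (PiM {..<n} (\<lambda>_. G)). b * n < S x \<and> S x < b * n + 2 * R}"
      have [measurable]: "E \<in> sets (PiM {..<n} (\<lambda>_. G))" unfolding E_def by measurable
      have int: "integrable (PiM {..<n} (\<lambda>_. G)) (\<lambda>x. 1 / (1 + ((S x - a) / R)\<^sup>2))"
        by (rule P.integrable_const_bound[where B = 1]) (auto simp: add_pos_nonneg divide_le_eq)
      have "c / 2 / sqrt n \<le> (LBINT t. tri t * Re (iexp (t / R0 * (card {..<n} * b - a)) * cf (t / R0) ^ card {..<n}))"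
        using elim by (simp add: a_def field_simps)
      also have "\<dots> = P.expectation (\<lambda>x. fejer ((S x - a) / R0))"
        unfolding S_def using R0 by (intro expectation_fejer_sum[symmetric]) auto
      also have "\<dots> \<le> P.expectation (\<lambda>x. indicator E x + 8 * R0\<^sup>2 / R\<^sup>2 * (1 / (1 + ((S x - a) / R)\<^sup>2)))"
      proof (rule integral_mono)
        show "integrable (PiM {..<n} (\<lambda>_. G)) (\<lambda>x. fejer ((S x - a) / R0))"
          by (rule P.integrable_const_bound[where B = 1]) (auto simp: fejer_nonneg fejer_le_1)
        show "integrable (PiM {..<n} (\<lambda>_. G)) (\<lambda>x. indicator E x + 8 * R0\<^sup>2 / R\<^sup>2 * (1 / (1 + ((S x - a) / R)\<^sup>2)))"
          by (intro Bochner_Integration.integrable_add integrable_mult_right int integrable_real_indicator)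
             (auto simp: P.emeasure_eq_measure)
        show "fejer ((S x - a) / R0) \<le> indicator E x + 8 * R0\<^sup>2 / R\<^sup>2 * (1 / (1 + ((S x - a) / R)\<^sup>2))"
          if "x \<in> space (PiM {..<n} (\<lambda>_. G))" for x
        proof -
          have "indicator {-R<..<R} (S x - a) = (indicator E x :: real)"
            using that by (auto simp: E_def a_def indicator_def)
          then show ?thesis using fejer_bound[of "S x - a"] by simp
        qed
      qed
      also have "\<dots> = P.expectation (indicator E) + P.expectation (\<lambda>x. 8 * R0\<^sup>2 / R\<^sup>2 * (1 / (1 + ((S x - a) / R)\<^sup>2)))"
        by (intro Bochner_Integration.integral_add integrable_mult_right int integrable_real_indicator)
           (auto simp: P.emeasure_eq_measure)
      also have "P.expectation (\<lambda>x. 8 * R0\<^sup>2 / R\<^sup>2 * (1 / (1 + ((S x - a) / R)\<^sup>2)))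
          = 8 * R0\<^sup>2 / R\<^sup>2 * P.expectation (\<lambda>x. 1 / (1 + ((S x - a) / R)\<^sup>2))"
        by (rule integral_mult_right_zero)
      also have "P.expectation (indicator E) = P.prob E" by simp
      also have "P.prob E + 8 * R0\<^sup>2 / R\<^sup>2 * P.expectation (\<lambda>x. 1 / (1 + ((S x - a) / R)\<^sup>2))
          \<le> P.prob E + 8 * R0\<^sup>2 / R\<^sup>2 * (C * R / sqrt n)"
        using conc[of "{..<n}" R a] R elim by (intro add_left_mono mult_left_mono) (auto simp: S_def)
      also have "8 * R0\<^sup>2 / R\<^sup>2 * (C * R / sqrt n) = (8 * R0\<^sup>2 * C / R) / sqrt n"
        using R by (simp add: power2_eq_square)
      also have "\<dots> \<le> (c / 4) / sqrt n" by (intro divide_right_mono Rc) simp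
      finally show ?case by (simp add: E_def S_def)
    qed
  qed
qed

end

subsection \<open>Change of measure\<close>

text \<open>Rectangles determine the product measure, and on them density and indicator both factor
  over the coordinates. Truncation and tilting are both densities with respect to \<open>F\<close>,
  so this one identity serves for both.\<close>

lemma PiM_density:
  assumes F: "prob_space F" and f[measurable]: "f \<in> borel_measurable F"
    and D: "prob_space (density F f)" and I: "finite I"
  shows "PiM I (\<lambda>_. density F f) = density (PiM I (\<lambda>_. F)) (\<lambda>x. \<Prod>i\<in>I. f (x i))"
proof -
  interpret F: product_sigma_finite "\<lambda>_. F"
    by (intro product_sigma_finite.intro prob_space_imp_sigma_finite F)
  interpret D: product_sigma_finite "\<lambda>_. density F f"
    by (intro product_sigma_finite.intro prob_space_imp_sigma_finite D)
  show ?thesis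
  proof (rule D.PiM_eqI[symmetric, OF I])
    show "sets (density (PiM I (\<lambda>_. F)) (\<lambda>x. \<Prod>i\<in>I. f (x i))) = sets (PiM I (\<lambda>_. density F f))"
      by (simp cong: sets_PiM_cong)
    fix A assume A: "\<And>i. i \<in> I \<Longrightarrow> A i \<in> sets (density F f)"
    then have A': "\<And>i. i \<in> I \<Longrightarrow> A i \<in> sets F" by simp
    have [measurable]: "Pi\<^sub>E I A \<in> sets (PiM I (\<lambda>_. F))" by (intro sets_PiM_I_finite I A')
    have "emeasure (density (PiM I (\<lambda>_. F)) (\<lambda>x. \<Prod>i\<in>I. f (x i))) (Pi\<^sub>E I A)
      = (\<integral>\<^sup>+x. (\<Prod>i\<in>I. f (x i)) * indicator (Pi\<^sub>E I A) x \<partial>PiM I (\<lambda>_. F))"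
      by (intro emeasure_density) auto
    also have "\<dots> = (\<integral>\<^sup>+x. (\<Prod>i\<in>I. f (x i) * indicator (A i) (x i)) \<partial>PiM I (\<lambda>_. F))"
    proof (rule nn_integral_cong)
      fix x assume "x \<in> space (PiM I (\<lambda>_. F))"
      then have "x \<in> Pi\<^sub>E I A \<longleftrightarrow> (\<forall>i\<in>I. x i \<in> A i)" by (auto simp: space_PiM PiE_iff)
      then have "indicator (Pi\<^sub>E I A) x = (\<Prod>i\<in>I. indicator (A i) (x i) :: ennreal)"
        using I by (auto simp: indicator_def intro!: prod.neutral[symmetric] prod_zero[symmetric])
      then show "(\<Prod>i\<in>I. f (x i)) * indicator (Pi\<^sub>E I A) x = (\<Prod>i\<in>I. f (x i) * indicator (A i) (x i))"
        by (simp add: prod.distrib)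
    qed
    also have "\<dots> = (\<Prod>i\<in>I. \<integral>\<^sup>+x. f x * indicator (A i) x \<partial>F)"
      by (intro F.product_nn_integral_prod I borel_measurable_times_ennreal f borel_measurable_indicator A')
    also have "\<dots> = (\<Prod>i\<in>I. emeasure (density F f) (A i))"
      using A' by (intro prod.cong refl emeasure_density[symmetric]) auto
    finally show "emeasure (density (PiM I (\<lambda>_. F)) (\<lambda>x. \<Prod>i\<in>I. f (x i))) (Pi\<^sub>E I A)
      = (\<Prod>i\<in>I. emeasure (density F f) (A i))" .
  qed
qed

text \<open>The product density is the constant \<open>1 / measure F A ^ card I\<close> on the cube
  over \<open>A\<close> and zero elsewhere: conditioning each coordinate is conditioning the sample
  on the cube.\<close>

lemma measure_PiM_uniform_measure:
  assumes F: "prob_space F" and A: "A \<in> sets F" and pos: "0 < measure F A" and I: "finite I"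
    and E: "E \<in> sets (PiM I (\<lambda>_. F))"
  shows "measure (PiM I (\<lambda>_. uniform_measure F A)) E
    = measure (PiM I (\<lambda>_. F)) {x \<in> E. \<forall>i\<in>I. x i \<in> A} / measure F A ^ card I"
proof -
  interpret F: prob_space F by fact
  interpret P: prob_space "PiM I (\<lambda>_. F)" by (intro prob_space_PiM F)
  define q where "q = measure F A"
  have q: "0 < q" "emeasure F A = ennreal q" using pos by (auto simp: q_def F.emeasure_eq_measure)
  note A[measurable] E[measurable]
  let ?f = "\<lambda>x. indicator A x / emeasure F A :: ennreal"
  have D: "prob_space (uniform_measure F A)"
    using q by (intro prob_space_uniform_measure) auto
  have E': "{x \<in> E. \<forall>i\<in>I. x i \<in> A} \<in> sets (PiM I (\<lambda>_. F))"
  proof -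
    have "{x \<in> E. \<forall>i\<in>I. x i \<in> A} = E \<inter> (PiE I (\<lambda>_. A))"
      using sets.sets_into_space[OF E] by (auto simp: space_PiM PiE_iff)
    then show ?thesis using E A I by (auto intro!: sets_PiM_I_finite)
  qed
  have "PiM I (\<lambda>_. uniform_measure F A) = density (PiM I (\<lambda>_. F)) (\<lambda>x. \<Prod>i\<in>I. ?f (x i))"
    using D unfolding uniform_measure_def by (intro PiM_density F I) auto
  then have "emeasure (PiM I (\<lambda>_. uniform_measure F A)) E
    = (\<integral>\<^sup>+x. (\<Prod>i\<in>I. ?f (x i)) * indicator E x \<partial>PiM I (\<lambda>_. F))"
    by (simp add: emeasure_density)
  also have "\<dots> = (\<integral>\<^sup>+x. ennreal ((1 / q) ^ card I) * indicator {x \<in> E. \<forall>i\<in>I. x i \<in> A} x \<partial>PiM I (\<lambda>_. F))"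
  proof (intro nn_integral_cong)
    fix x :: "'b \<Rightarrow> 'a"
    have "(\<Prod>i\<in>I. ?f (x i)) = ennreal ((1 / q) ^ card I)" if "\<forall>i\<in>I. x i \<in> A"
    proof -
      have "(\<Prod>i\<in>I. ?f (x i)) = (\<Prod>i\<in>I. ennreal (1 / q))"
        using that q by (intro prod.cong) (auto simp: divide_ennreal simp flip: ennreal_1)
      then show ?thesis using q by (simp add: ennreal_power)
    qed
    moreover have "(\<Prod>i\<in>I. ?f (x i)) = 0" if "\<not> (\<forall>i\<in>I. x i \<in> A)"
    proof -
      from that obtain i where "i \<in> I" "x i \<notin> A" by auto
      then show ?thesis using I by (intro prod_zero bexI[of _ i]) auto
    qed
    ultimately show "(\<Prod>i\<in>I. ?f (x i)) * indicator E x
        = ennreal ((1 / q) ^ card I) * indicator {x \<in> E. \<forall>i\<in>I. x i \<in> A} x"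
      by (auto simp: indicator_def)
  qed
  also have "\<dots> = ennreal ((1 / q) ^ card I) * emeasure (PiM I (\<lambda>_. F)) {x \<in> E. \<forall>i\<in>I. x i \<in> A}"
    using E' by (rule nn_integral_cmult_indicator)
  also have "\<dots> = ennreal ((1 / q) ^ card I * P.prob {x \<in> E. \<forall>i\<in>I. x i \<in> A})"
    using q by (simp add: P.emeasure_eq_measure ennreal_mult)
  finally show ?thesis
    using q by (simp add: measure_def[of "PiM I (\<lambda>_. uniform_measure F A)"] q_def power_one_over)
qed

section \<open>Exponential tilting and the saddle point\<close>

definition tilt :: "real measure \<Rightarrow> real \<Rightarrow> real measure" where
  "tilt F \<theta> = density F (\<lambda>x. ennreal (exp (\<theta> * x) / (\<integral>x. exp (\<theta> * x) \<partial>F)))"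

context
  fixes F :: "real measure"
  assumes F: "prob_space F" and sF [measurable_cong]: "sets F = sets borel"
begin

interpretation F: prob_space F by (rule F)

lemma integrable_exp_cgf_dom: "\<theta> \<in> cgf_dom F \<Longrightarrow> integrable F (\<lambda>x. exp (\<theta> * x))"
  by (rule integrableI_bounded) (auto simp: cgf_dom_def)

text \<open>In the interior, \<open>\<theta>\<close> can move by some \<open>e\<close> in both
  directions. The power is at most a multiple of \<open>exp (e * \<bar>x - a\<bar>)\<close>, which
  the sum of the exponentials on the two sides dominates.\<close>

lemma integrable_power_exp:
  assumes "\<theta> \<in> interior (cgf_dom F)"
  shows "integrable F (\<lambda>x. (x - a) ^ k * exp (\<theta> * x))"
proof -
  obtain e where e: "0 < e" "cball \<theta> e \<subseteq> cgf_dom F"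
    using assms unfolding mem_interior_cball by blast
  have "\<theta> + e \<in> cgf_dom F" "\<theta> - e \<in> cgf_dom F"
    using e by (auto simp: dist_real_def intro!: subsetD[OF e(2)])
  note int = this[THEN integrable_exp_cgf_dom]
  \<comment> \<open>From \<open>z \<le> exp z\<close> at \<open>z = e * y / Suc k\<close>, raised to
    the power \<open>k\<close>. Using \<open>Suc k\<close> instead of \<open>k\<close> avoids a
    division by zero for \<open>k = 0\<close>.\<close>
  define K where "K = (Suc k / e) ^ k"
  have K: "0 \<le> K" unfolding K_def using e by simp
  show ?thesis
  proof (rule Bochner_Integration.integrable_bound)
    show "integrable F (\<lambda>x. K * (exp (- e * a) * exp ((\<theta> + e) * x) + exp (e * a) * exp ((\<theta> - e) * x)))"
      using int by simp
    show "AE x in F. norm ((x - a) ^ k * exp (\<theta> * x))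
      \<le> norm (K * (exp (- e * a) * exp ((\<theta> + e) * x) + exp (e * a) * exp ((\<theta> - e) * x)))"
    proof (rule AE_I2)
      fix x
      define y where "y = \<bar>x - a\<bar>"
      have y: "0 \<le> y" by (simp add: y_def)
      have "e * y / Suc k \<le> exp (e * y / Suc k)"
        using exp_ge_add_one_self[of "e * y / Suc k"] by linarith
      then have "(e * y / Suc k) ^ k \<le> exp (e * y / Suc k) ^ k"
        using e y by (intro power_mono) auto
      also have "\<dots> = exp (real k * (e * y / Suc k))" by (simp only: exp_of_nat_mult)
      also have "\<dots> \<le> exp (e * y)"
        using e y by (auto simp: divide_simps algebra_simps)
      finally have "K * (e * y / Suc k) ^ k \<le> K * exp (e * y)" using K by (intro mult_left_mono)
      moreover have "K * (e * y / Suc k) ^ k = y ^ k"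
        unfolding K_def using e by (simp add: power_mult_distrib[symmetric] del: of_nat_Suc)
      ultimately have "y ^ k \<le> K * exp (e * y)" by simp
      also have "exp (e * y) \<le> exp (e * (x - a)) + exp (- e * (x - a))"
        unfolding y_def by (cases "a \<le> x") (auto simp: algebra_simps)
      then have "K * exp (e * y) \<le> K * (exp (e * (x - a)) + exp (- e * (x - a)))"
        using K by (rule mult_left_mono)
      finally have "y ^ k * exp (\<theta> * x) \<le> K * (exp (e * (x - a)) + exp (- e * (x - a))) * exp (\<theta> * x)"
        by (intro mult_right_mono) auto
      also have "\<dots> = K * (exp (- e * a) * exp ((\<theta> + e) * x) + exp (e * a) * exp ((\<theta> - e) * x))"
        by (simp add: algebra_simps exp_add[symmetric])
      finally show "norm ((x - a) ^ k * exp (\<theta> * x))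
        \<le> norm (K * (exp (- e * a) * exp ((\<theta> + e) * x) + exp (e * a) * exp ((\<theta> - e) * x)))"
        using K by (simp add: abs_mult power_abs y_def)
    qed
  qed simp
qed

lemma integral_exp_pos:
  assumes "\<theta> \<in> cgf_dom F"
  shows "0 < (\<integral>x. exp (\<theta> * x) \<partial>F)"
proof -
  have "(\<integral>x. exp (\<theta> * x) \<partial>F) \<noteq> 0"
  proof
    assume "(\<integral>x. exp (\<theta> * x) \<partial>F) = 0"
    then have "AE x in F. exp (\<theta> * x) = 0"
      using integral_nonneg_eq_0_iff_AE[OF integrable_exp_cgf_dom[OF assms]] by simp
    then show False by (simp add: F.AE_const)
  qed
  moreover have "0 \<le> (\<integral>x. exp (\<theta> * x) \<partial>F)" by (rule Bochner_Integration.integral_nonneg) simp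
  ultimately show ?thesis by linarith
qed

text \<open>The tangent line at \<open>\<theta>\<close>, obtained by integrating \<open>exp z \<ge> 1 + z\<close>, lies below the transform; this
  identifies its slope as the derivative without differentiating under the integral.\<close>

lemma saddle_point_mean:
  assumes ts: "\<theta> \<in> interior (cgf_dom F)" and d: "(cgf F has_real_derivative b) (at \<theta>)"
  shows "(\<integral>x. (x - b) * exp (\<theta> * x) \<partial>F) = 0"
proof -
  obtain e where e: "0 < e" "ball \<theta> e \<subseteq> cgf_dom F"
    using ts unfolding mem_interior by blast
  define m where "m = (\<integral>x. (x - b) * exp (\<theta> * x) \<partial>F)"
  define h where "h t = exp (cgf F t - t * b)" for t
  have h: "h t = (\<integral>x. exp (- t * b) * exp (t * x) \<partial>F)" if "t \<in> cgf_dom F" for t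
    using integral_exp_pos[OF that] by (simp add: h_def cgf_def exp_diff exp_minus field_simps)
  \<comment> \<open>Since \<open>h\<close> is stationary, the slope of the difference is that of the
    subtracted line alone. The difference has a local minimum at \<open>\<theta>\<close>, so this
    slope, a nonzero multiple of \<open>m\<close>, must vanish.\<close>
  have "((\<lambda>t. h t - (t - \<theta>) * (exp (- \<theta> * b) * m)) has_real_derivative (0 - exp (- \<theta> * b) * m)) (at \<theta>)"
    unfolding h_def by (auto intro!: derivative_eq_intros d)
  moreover have "\<forall>t. \<bar>\<theta> - t\<bar> < e \<longrightarrow>
      h \<theta> - (\<theta> - \<theta>) * (exp (- \<theta> * b) * m) \<le> h t - (t - \<theta>) * (exp (- \<theta> * b) * m)"
  proof (intro allI impI)
    fix t assume "\<bar>\<theta> - t\<bar> < e"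
    then have t: "t \<in> cgf_dom F" and th: "\<theta> \<in> cgf_dom F"
      using e by (auto simp: dist_real_def intro!: subsetD[OF e(2)])
    have int1: "integrable F (\<lambda>x. (x - b) * exp (\<theta> * x))"
      using integrable_power_exp[OF ts, of b 1] by simp
    have "h \<theta> + (t - \<theta>) * (exp (- \<theta> * b) * m)
      = (\<integral>x. exp (- \<theta> * b) * exp (\<theta> * x) + (t - \<theta>) * (exp (- \<theta> * b) * ((x - b) * exp (\<theta> * x))) \<partial>F)"
      unfolding h[OF th] m_def using int1 integrable_exp_cgf_dom[OF th]
      by (subst Bochner_Integration.integral_add) auto
    also have "\<dots> \<le> (\<integral>x. exp (- t * b) * exp (t * x) \<partial>F)"
    proof (rule integral_mono)
      fix x
      have "exp (\<theta> * (x - b)) * (1 + (t - \<theta>) * (x - b)) \<le> exp (\<theta> * (x - b)) * exp ((t - \<theta>) * (x - b))"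
        by (intro mult_left_mono exp_ge_add_one_self) auto
      then show "exp (- \<theta> * b) * exp (\<theta> * x) + (t - \<theta>) * (exp (- \<theta> * b) * ((x - b) * exp (\<theta> * x)))
          \<le> exp (- t * b) * exp (t * x)"
        by (simp add: exp_add[symmetric] algebra_simps)
    qed (use int1 integrable_exp_cgf_dom[OF th] integrable_exp_cgf_dom[OF t] in auto)
    also have "\<dots> = h t" by (rule h[OF t, symmetric])
    finally show "h \<theta> - (\<theta> - \<theta>) * (exp (- \<theta> * b) * m) \<le> h t - (t - \<theta>) * (exp (- \<theta> * b) * m)" by simp
  qed
  ultimately have "0 - exp (- \<theta> * b) * m = 0" by (rule DERIV_local_min[OF _ e(1)])
  then show ?thesis by (simp add: m_def)
qed

text \<open>If \<open>\<theta> \<le> 0\<close>, then \<open>x\<close> and \<open>exp (\<theta> * x)\<close> are oppositely ordered, so tilting cannot raise the mean.\<close>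

lemma saddle_point_pos:
  assumes ts: "\<theta> \<in> interior (cgf_dom F)" and z: "0 \<in> interior (cgf_dom F)"
    and mean: "(\<integral>x. (x - b) * exp (\<theta> * x) \<partial>F) = 0" and b: "(\<integral>x. x \<partial>F) < b"
  shows "0 < \<theta>"
proof (rule ccontr)
  assume "\<not> 0 < \<theta>"
  then have neg: "\<theta> \<le> 0" by simp
  define \<mu> where "\<mu> = (\<integral>x. x \<partial>F)"
  have int: "integrable F (\<lambda>x. x)" using integrable_power_exp[OF z, of 0 1] by simp
  have th: "\<theta> \<in> cgf_dom F" using ts interior_subset by blast
  have int1: "integrable F (\<lambda>x. (x - b) * exp (\<theta> * x))"
    using integrable_power_exp[OF ts, of b 1] by simp
  have int2: "integrable F (\<lambda>x. (x - \<mu>) * exp (\<theta> * x))"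
    using integrable_power_exp[OF ts, of \<mu> 1] by simp
  \<comment> \<open>The first term integrates to 0, so this bounds the tilted integral of
    \<open>x - \<mu>\<close> by 0 from above. Yet \<open>mean\<close> makes the same integral equal
    to \<open>b - \<mu>\<close> times the transform, which is positive.\<close>
  have "0 \<le> (\<integral>x. (x - \<mu>) * exp (\<theta> * \<mu>) - (x - \<mu>) * exp (\<theta> * x) \<partial>F)"
  proof (rule Bochner_Integration.integral_nonneg)
    fix x
    show "0 \<le> (x - \<mu>) * exp (\<theta> * \<mu>) - (x - \<mu>) * exp (\<theta> * x)"
    proof (cases "x \<le> \<mu>")
      case True
      then have "exp (\<theta> * \<mu>) \<le> exp (\<theta> * x)" using neg by (simp add: mult_left_mono_neg)
      then show ?thesis using mult_left_mono_neg[of "exp (\<theta> * \<mu>)" "exp (\<theta> * x)" "x - \<mu>"] True by simp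
    next
      case False
      then have "exp (\<theta> * x) \<le> exp (\<theta> * \<mu>)" using neg by (simp add: mult_left_mono_neg)
      then show ?thesis using mult_left_mono[of "exp (\<theta> * x)" "exp (\<theta> * \<mu>)" "x - \<mu>"] False by simp
    qed
  qed
  moreover have "(\<integral>x. (x - \<mu>) * exp (\<theta> * \<mu>) - (x - \<mu>) * exp (\<theta> * x) \<partial>F)
      = - (\<integral>x. (x - \<mu>) * exp (\<theta> * x) \<partial>F)"
    using int int2 by (simp add: \<mu>_def F.prob_space)
  moreover have "(\<integral>x. (x - \<mu>) * exp (\<theta> * x) \<partial>F)
     = (\<integral>x. (x - b) * exp (\<theta> * x) + (b - \<mu>) * exp (\<theta> * x) \<partial>F)"
    by (simp add: algebra_simps)
  moreover have "\<dots> = (b - \<mu>) * (\<integral>x. exp (\<theta> * x) \<partial>F)"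
    using int1 integrable_exp_cgf_dom[OF th] mean by (subst Bochner_Integration.integral_add) auto
  moreover have "0 < (b - \<mu>) * (\<integral>x. exp (\<theta> * x) \<partial>F)"
    using b integral_exp_pos[OF th] by (simp add: \<mu>_def)
  ultimately show False by simp
qed

lemma prob_space_tilt:
  assumes "\<theta> \<in> cgf_dom F"
  shows "prob_space (tilt F \<theta>)"
proof
  note int = integrable_exp_cgf_dom[OF assms] and pos = integral_exp_pos[OF assms]
  have "emeasure (tilt F \<theta>) (space (tilt F \<theta>)) = (\<integral>\<^sup>+x. ennreal (exp (\<theta> * x) / (\<integral>x. exp (\<theta> * x) \<partial>F)) \<partial>F)"
    by (simp add: tilt_def emeasure_density cong: nn_integral_cong)
  also have "\<dots> = ennreal (\<integral>x. exp (\<theta> * x) / (\<integral>x. exp (\<theta> * x) \<partial>F) \<partial>F)"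
    using int pos by (intro nn_integral_eq_integral) auto
  also have "\<dots> = 1" using pos by simp
  finally show "emeasure (tilt F \<theta>) (space (tilt F \<theta>)) = 1" .
qed

lemma sets_tilt [simp, measurable_cong]: "sets (tilt F \<theta>) = sets borel"
  by (simp add: tilt_def sF)

lemma
  fixes h :: "real \<Rightarrow> real"
  assumes th: "\<theta> \<in> cgf_dom F" and [measurable]: "h \<in> borel_measurable borel"
  shows integrable_tilt: "integrable F (\<lambda>x. h x * exp (\<theta> * x)) \<Longrightarrow> integrable (tilt F \<theta>) h"
    and integral_tilt: "integral\<^sup>L (tilt F \<theta>) h = (\<integral>x. h x * exp (\<theta> * x) \<partial>F) / (\<integral>x. exp (\<theta> * x) \<partial>F)"
proof -
  note pos = integral_exp_pos[OF th]
  show "integrable F (\<lambda>x. h x * exp (\<theta> * x)) \<Longrightarrow> integrable (tilt F \<theta>) h"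
    unfolding tilt_def using pos by (subst integrable_real_density) (auto simp: mult.commute)
  show "integral\<^sup>L (tilt F \<theta>) h = (\<integral>x. h x * exp (\<theta> * x) \<partial>F) / (\<integral>x. exp (\<theta> * x) \<partial>F)"
    unfolding tilt_def using pos by (subst integral_real_density) (auto simp: mult.commute)
qed

lemma AE_tilt:
  assumes th: "\<theta> \<in> cgf_dom F"
  shows "(AE x in tilt F \<theta>. P x) \<longleftrightarrow> (AE x in F. P x)"
  unfolding tilt_def using integral_exp_pos[OF th]
  by (subst AE_density) auto

text \<open>A positive density preserves null sets, so the tilt is a point mass at \<open>b\<close>
  only if \<open>F\<close> is. The interior position of \<open>\<theta>\<close> provides the third
  moment, and the saddle point equation the mean.\<close>

lemma nondegenerate_law_tilt:
  assumes ts: "\<theta> \<in> interior (cgf_dom F)" and d: "(cgf F has_real_derivative b) (at \<theta>)"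
    and nd: "\<not> (AE x in F. x = b)"
  shows "nondegenerate_law (tilt F \<theta>) b"
proof -
  have th: "\<theta> \<in> cgf_dom F" using ts interior_subset by blast
  interpret T: prob_space "tilt F \<theta>" by (rule prob_space_tilt[OF th])
  show ?thesis
  proof
    show "integrable (tilt F \<theta>) (\<lambda>x. \<bar>x - b\<bar> ^ 3)"
      using integrable_abs[OF integrable_power_exp[OF ts, of b 3]]
      by (intro integrable_tilt th) (auto simp: abs_mult power_abs)
    show "T.expectation (\<lambda>x. x - b) = 0"
      by (subst integral_tilt[OF th]) (auto simp: saddle_point_mean[OF ts d])
    show "\<not> (AE x in tilt F \<theta>. x = b)" using nd by (simp add: AE_tilt[OF th])
  qed simp
qed

text \<open>Markov's inequality under the tilt, with weight
  \<open>exp (\<theta>' * (x - u))\<close>. The factor \<open>exp (- \<theta>' * u)\<close> is the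
  one that the growth condition on the truncation level controls.\<close>

lemma emeasure_tilt_greaterThan_le:
  assumes th: "\<theta> \<in> cgf_dom F" and th': "\<theta> + \<theta>' \<in> cgf_dom F" and pos: "0 < \<theta>'"
  shows "emeasure (tilt F \<theta>) {u<..}
    \<le> ennreal (exp (- \<theta>' * u) * ((\<integral>x. exp ((\<theta> + \<theta>') * x) \<partial>F) / (\<integral>x. exp (\<theta> * x) \<partial>F)))"
proof -
  note Mpos = integral_exp_pos[OF th]
  have "emeasure (tilt F \<theta>) {u<..}
    = (\<integral>\<^sup>+x. ennreal (exp (\<theta> * x) / (\<integral>x. exp (\<theta> * x) \<partial>F)) * indicator {u<..} x \<partial>F)"
    unfolding tilt_def by (simp add: emeasure_density sF)
  also have "\<dots> \<le> (\<integral>\<^sup>+x. ennreal (exp (- \<theta>' * u) * exp ((\<theta> + \<theta>') * x) / (\<integral>x. exp (\<theta> * x) \<partial>F)) \<partial>F)"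
  proof (rule nn_integral_mono)
    fix x
    have "exp (\<theta> * x) \<le> exp (- \<theta>' * u) * exp ((\<theta> + \<theta>') * x)" if "u < x"
    proof -
      have "\<theta>' * u \<le> \<theta>' * x" using that pos by (intro mult_left_mono) auto
      then show ?thesis by (simp add: exp_add[symmetric] algebra_simps)
    qed
    then show "ennreal (exp (\<theta> * x) / (\<integral>x. exp (\<theta> * x) \<partial>F)) * indicator {u<..} x
      \<le> ennreal (exp (- \<theta>' * u) * exp ((\<theta> + \<theta>') * x) / (\<integral>x. exp (\<theta> * x) \<partial>F))"
      using Mpos by (auto simp: indicator_def intro!: ennreal_leI divide_right_mono)
  qed
  also have "\<dots> = ennreal (\<integral>x. exp (- \<theta>' * u) * exp ((\<theta> + \<theta>') * x) / (\<integral>x. exp (\<theta> * x) \<partial>F) \<partial>F)"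
    using integrable_exp_cgf_dom[OF th'] Mpos by (intro nn_integral_eq_integral) auto
  finally show ?thesis by simp
qed

section \<open>Tail and big-jump estimates through the tilted sample\<close>

lemma emeasure_PiM_tilt:
  fixes I :: "'i set"
  assumes th: "\<theta> \<in> cgf_dom F" and I: "finite I" and E[measurable]: "E \<in> sets (PiM I (\<lambda>_. F))"
  shows "emeasure (PiM I (\<lambda>_. F)) E
    = (\<integral>\<^sup>+x. ennreal ((\<integral>x. exp (\<theta> * x) \<partial>F) ^ card I * exp (- \<theta> * (\<Sum>i\<in>I. x i))) * indicator E x
        \<partial>PiM I (\<lambda>_. tilt F \<theta>))"
proof -
  define M where "M = (\<integral>x. exp (\<theta> * x) \<partial>F)"
  have M: "0 < M" unfolding M_def by (rule integral_exp_pos[OF th])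
  have eq: "PiM I (\<lambda>_. tilt F \<theta>) = density (PiM I (\<lambda>_. F)) (\<lambda>x. \<Prod>i\<in>I. ennreal (exp (\<theta> * x i) / M))"
    unfolding tilt_def M_def
    by (intro PiM_density F I prob_space_tilt[OF th, unfolded tilt_def]) auto
  have "(\<integral>\<^sup>+x. ennreal (M ^ card I * exp (- \<theta> * (\<Sum>i\<in>I. x i))) * indicator E x \<partial>PiM I (\<lambda>_. tilt F \<theta>))
    = (\<integral>\<^sup>+x. (\<Prod>i\<in>I. ennreal (exp (\<theta> * x i) / M))
        * (ennreal (M ^ card I * exp (- \<theta> * (\<Sum>i\<in>I. x i))) * indicator E x) \<partial>PiM I (\<lambda>_. F))"
    unfolding eq by (intro nn_integral_density) auto
  also have "\<dots> = (\<integral>\<^sup>+x. indicator E x \<partial>PiM I (\<lambda>_. F))"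
  proof (rule nn_integral_cong)
    fix x
    have "(\<Prod>i\<in>I. ennreal (exp (\<theta> * x i) / M)) = ennreal (\<Prod>i\<in>I. exp (\<theta> * x i) / M)"
      using M by (intro prod_ennreal) auto
    also have "(\<Prod>i\<in>I. exp (\<theta> * x i) / M) = exp (\<theta> * (\<Sum>i\<in>I. x i)) / M ^ card I"
      using I by (simp add: prod_dividef exp_sum sum_distrib_left)
    finally have "(\<Prod>i\<in>I. ennreal (exp (\<theta> * x i) / M)) * ennreal (M ^ card I * exp (- \<theta> * (\<Sum>i\<in>I. x i))) = 1"
      using M by (simp add: ennreal_mult[symmetric] exp_minus)
    then show "(\<Prod>i\<in>I. ennreal (exp (\<theta> * x i) / M))
        * (ennreal (M ^ card I * exp (- \<theta> * (\<Sum>i\<in>I. x i))) * indicator E x) = indicator E x"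
      by (simp add: mult.assoc[symmetric])
  qed
  also have "\<dots> = emeasure (PiM I (\<lambda>_. F)) E" by simp
  finally show ?thesis by (simp add: M_def)
qed

text \<open>Restrict to the window between \<open>b * n\<close> and \<open>b * n + R\<close>. There
  the inverse tilting weight loses at most the factor \<open>exp (- \<theta> * R)\<close> against
  its value at \<open>b * n\<close>, and \<open>local_lower_bound\<close> gives the tilted
  probability of the window.\<close>

lemma tail_prob_ge:
  assumes ts: "\<theta> \<in> interior (cgf_dom F)" and d: "(cgf F has_real_derivative b) (at \<theta>)"
    and nd: "\<not> (AE x in F. x = b)" and pos: "0 < \<theta>"
  obtains c where "0 < c"
    "\<forall>\<^sub>F n in sequentially. (\<integral>x. exp (\<theta> * x) \<partial>F) ^ n * exp (- \<theta> * (b * n)) * (c / sqrt n)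
        \<le> tail_prob n (b * n) F"
proof -
  have th: "\<theta> \<in> cgf_dom F" using ts interior_subset by blast
  interpret N: nondegenerate_law "tilt F \<theta>" b by (rule nondegenerate_law_tilt[OF ts d nd])
  define M where "M = (\<integral>x. exp (\<theta> * x) \<partial>F)"
  have M: "0 < M" unfolding M_def by (rule integral_exp_pos[OF th])
  obtain R c where Rc: "0 < R" "0 < c" and ev:
    "\<forall>\<^sub>F n in sequentially. c / sqrt n \<le> measure (PiM {..<n::nat} (\<lambda>_. tilt F \<theta>))
        {x \<in> space (PiM {..<n} (\<lambda>_. tilt F \<theta>)). b * n < (\<Sum>i<n. x i) \<and> (\<Sum>i<n. x i) < b * n + R}"
    by (rule N.local_lower_bound) blast
  show thesis
  proof (rule that[of "exp (- \<theta> * R) * c"])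
    show "0 < exp (- \<theta> * R) * c" using Rc by simp
    show "\<forall>\<^sub>F n in sequentially. (\<integral>x. exp (\<theta> * x) \<partial>F) ^ n * exp (- \<theta> * (b * n)) * (exp (- \<theta> * R) * c / sqrt n)
        \<le> tail_prob n (b * n) F"
      using ev
    proof eventually_elim
      case (elim n)
      let ?PF = "PiM {..<n} (\<lambda>_. F)" and ?PG = "PiM {..<n} (\<lambda>_. tilt F \<theta>)"
      interpret PF: prob_space ?PF by (intro prob_space_PiM F)
      interpret PG: prob_space ?PG by (rule N.prob_space_sample)
      have sets_eq: "sets ?PF = sets ?PG" by (intro sets_PiM_cong) (auto simp: sF)
      have space_eq: "space ?PF = space ?PG" by (rule sets_eq_imp_space_eq[OF sets_eq])
      define K where "K = M ^ n * exp (- \<theta> * (b * n)) * exp (- \<theta> * R)"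
      have K: "0 \<le> K" unfolding K_def using M by simp
      define A where "A = {x \<in> space ?PF. b * n < (\<Sum>i<n. x i)}"
      define E where "E = {x \<in> space ?PG. b * n < (\<Sum>i<n. x i) \<and> (\<Sum>i<n. x i) < b * n + R}"
      have A[measurable]: "A \<in> sets ?PF" unfolding A_def by measurable
      have E[measurable]: "E \<in> sets ?PG" unfolding E_def by measurable
      have "ennreal (K * PG.prob E) = (\<integral>\<^sup>+x. ennreal K * indicator E x \<partial>?PG)"
        using K by (subst nn_integral_cmult_indicator[OF E]) (simp add: PG.emeasure_eq_measure ennreal_mult)
      also have "\<dots> \<le> (\<integral>\<^sup>+x. ennreal (M ^ card {..<n} * exp (- \<theta> * (\<Sum>i<n. x i))) * indicator A x \<partial>?PG)"
      proof (rule nn_integral_mono)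
        fix x
        show "ennreal K * indicator E x \<le> ennreal (M ^ card {..<n} * exp (- \<theta> * (\<Sum>i<n. x i))) * indicator A x"
        proof (cases "x \<in> E")
          case True
          then have "\<theta> * (\<Sum>i<n. x i) \<le> \<theta> * (b * n + R)" using pos by (auto simp: E_def)
          then have "exp (- \<theta> * (b * n)) * exp (- \<theta> * R) \<le> exp (- \<theta> * (\<Sum>i<n. x i))"
            by (simp add: exp_add[symmetric] algebra_simps)
          then have "K \<le> M ^ n * exp (- \<theta> * (\<Sum>i<n. x i))"
            unfolding K_def using M by (simp add: mult.assoc mult_left_mono)
          moreover have "x \<in> A" using True by (auto simp: A_def E_def space_eq)
          ultimately show ?thesis using True by (simp add: ennreal_leI)
        qed simp
      qed
      also have "\<dots> = emeasure ?PF A"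
        unfolding M_def by (rule emeasure_PiM_tilt[OF th finite_lessThan A, symmetric])
      also have "\<dots> = ennreal (tail_prob n (b * n) F)"
        by (simp add: tail_prob_def A_def PF.emeasure_eq_measure)
      finally have "K * PG.prob E \<le> tail_prob n (b * n) F"
        by (subst (asm) ennreal_le_iff) (auto simp: tail_prob_def)
      moreover have "K * (c / sqrt n) \<le> K * PG.prob E"
        using elim K by (intro mult_left_mono) (auto simp: E_def)
      ultimately show ?case by (simp add: K_def M_def mult.assoc)
    qed
  qed
qed

text \<open>Union bound over the index \<open>j\<close> of a large summand. For a fixed value
  \<open>y\<close> of that summand, \<open>exp_tail_bound\<close> for the other \<open>n - 1\<close>
  ones gives a bound free of \<open>y\<close>; integrating over \<open>y > u\<close> leaves the
  tilted probability of \<open>{u<..}\<close>, to which the Chernoff bound applies. With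
  \<open>2 \<le> n\<close> the remaining index set is nonempty.\<close>

lemma prob_big_jump_le:
  assumes ts: "\<theta> \<in> interior (cgf_dom F)" and d: "(cgf F has_real_derivative b) (at \<theta>)"
    and nd: "\<not> (AE x in F. x = b)" and pos: "0 < \<theta>"
    and th': "\<theta> + \<theta>' \<in> cgf_dom F" and pos': "0 < \<theta>'"
  obtains C where "0 < C"
    "\<And>n u. 2 \<le> n \<Longrightarrow>
      measure (PiM {..<n} (\<lambda>_. F)) {x \<in> space (PiM {..<n} (\<lambda>_. F)). b * n < (\<Sum>i<n. x i) \<and> (\<exists>i<n. u < x i)}
        \<le> (\<integral>x. exp (\<theta> * x) \<partial>F) ^ n * exp (- \<theta> * (b * n)) * (C * (n * exp (- \<theta>' * u)) / sqrt n)"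
proof -
  have th: "\<theta> \<in> cgf_dom F" using ts interior_subset by blast
  interpret N: nondegenerate_law "tilt F \<theta>" b by (rule nondegenerate_law_tilt[OF ts d nd])
  interpret PP: product_sigma_finite "\<lambda>_. tilt F \<theta>" by unfold_locales
  define M where "M = (\<integral>x. exp (\<theta> * x) \<partial>F)"
  have M: "0 < M" unfolding M_def by (rule integral_exp_pos[OF th])
  define B where "B = (\<integral>x. exp ((\<theta> + \<theta>') * x) \<partial>F) / M"
  have B: "0 < B" unfolding B_def using M integral_exp_pos[OF th'] by simp
  obtain C where C: "0 < C" and tail:
    "\<And>(I :: nat set) a. finite I \<Longrightarrow> I \<noteq> {} \<Longrightarrow>
      (\<integral>\<^sup>+x. ennreal (exp (- \<theta> * ((\<Sum>i\<in>I. x i) - a))) * indicator {a<..} (\<Sum>i\<in>I. x i) \<partial>PiM I (\<lambda>_. tilt F \<theta>))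
        \<le> ennreal (C / sqrt (card I))"
    by (rule N.exp_tail_bound[OF pos]) blast
  show thesis
  proof (rule that[of "B * C * sqrt 2"])
    show "0 < B * C * sqrt 2" using B C by simp
    fix n :: nat and u :: real
    assume n: "2 \<le> n"
    let ?PF = "PiM {..<n} (\<lambda>_. F)" and ?PG = "PiM {..<n} (\<lambda>_. tilt F \<theta>)"
    interpret PF: prob_space ?PF by (intro prob_space_PiM F)
    have sets_eq: "sets ?PF = sets ?PG" by (intro sets_PiM_cong) (auto simp: sF)
    define K where "K = M ^ n * exp (- \<theta> * (b * n))"
    have K: "0 \<le> K" unfolding K_def using M by simp
    define E where "E j = {x \<in> space ?PF. b * n < (\<Sum>i<n. x i) \<and> u < x j}" for j
    have E[measurable]: "E j \<in> sets ?PF" if "j < n" for j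
    proof -
      have [measurable]: "j \<in> {..<n}" using that by simp
      show ?thesis unfolding E_def by measurable
    qed
    have one: "PF.prob (E j) \<le> K * (exp (- \<theta>' * u) * B) * (C / sqrt (real n - 1))" if j: "j < n" for j
    proof -
      define I where "I = {..<n} - {j}"
      have I: "finite I" "j \<notin> I" "insert j I = {..<n}" "card I = n - 1"
        unfolding I_def using j by auto
      have I0: "I \<noteq> {}" using I(4) n by (metis card.empty diff_is_0_eq not_numeral_le_zero numeral_2_eq_2 Suc_le_eq One_nat_def less_le_not_le)
      have EG: "E j \<in> sets (PiM (insert j I) (\<lambda>_. tilt F \<theta>))"
        using E[OF j] unfolding I(3) sets_eq .
      have "emeasure ?PF (E j)
        = (\<integral>\<^sup>+x. ennreal (M ^ card {..<n} * exp (- \<theta> * (\<Sum>i<n. x i))) * indicator (E j) x \<partial>?PG)"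
        unfolding M_def by (rule emeasure_PiM_tilt[OF th finite_lessThan E[OF j]])
      also have "\<dots> = (\<integral>\<^sup>+x. ennreal (M ^ n * exp (- \<theta> * (\<Sum>i\<in>insert j I. x i))) * indicator (E j) x \<partial>PiM (insert j I) (\<lambda>_. tilt F \<theta>))"
        by (simp add: I(3))
      also have "\<dots> = (\<integral>\<^sup>+y. \<integral>\<^sup>+x. ennreal (M ^ n * exp (- \<theta> * (\<Sum>i\<in>insert j I. (x(j := y)) i))) * indicator (E j) (x(j := y))
           \<partial>PiM I (\<lambda>_. tilt F \<theta>) \<partial>tilt F \<theta>)"
        by (intro PP.product_nn_integral_insert_rev I(1,2) borel_measurable_times_ennreal
            borel_measurable_indicator EG) measurable
      also have "\<dots> \<le> (\<integral>\<^sup>+y. ennreal (K * (C / sqrt (real n - 1))) * indicator {u<..} y \<partial>tilt F \<theta>)"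
      proof (rule nn_integral_mono)
        fix y
        \<comment> \<open>The level that the other summands must exceed. Measured from it, the
          weight is \<open>K\<close> times \<open>exp (- \<theta> * (S - ?a))\<close>, where
          \<open>S\<close> is the sum of the others, so the jump size enters through the level
          alone.\<close>
        let ?a = "b * n - y"
        have "(\<integral>\<^sup>+x. ennreal (M ^ n * exp (- \<theta> * (\<Sum>i\<in>insert j I. (x(j := y)) i))) * indicator (E j) (x(j := y)) \<partial>PiM I (\<lambda>_. tilt F \<theta>))
          \<le> (\<integral>\<^sup>+x. ennreal K * indicator {u<..} y
              * (ennreal (exp (- \<theta> * ((\<Sum>i\<in>I. x i) - ?a))) * indicator {?a<..} (\<Sum>i\<in>I. x i)) \<partial>PiM I (\<lambda>_. tilt F \<theta>))"
        proof (rule nn_integral_mono)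
          fix x :: "nat \<Rightarrow> real"
          have "(\<Sum>i\<in>I. (x(j := y)) i) = (\<Sum>i\<in>I. x i)"
            using I(2) by (intro sum.cong) auto
          then have s: "(\<Sum>i\<in>insert j I. (x(j := y)) i) = y + (\<Sum>i\<in>I. x i)" using I(1,2) by simp
          have "M ^ n * exp (- \<theta> * (y + (\<Sum>i\<in>I. x i))) = K * exp (- \<theta> * ((\<Sum>i\<in>I. x i) - ?a))"
            by (simp add: K_def mult.assoc exp_add[symmetric] algebra_simps)
          moreover have "u < y \<and> ?a < (\<Sum>i\<in>I. x i)" if "x(j := y) \<in> E j"
            using that s unfolding E_def I(3) by auto
          ultimately show "ennreal (M ^ n * exp (- \<theta> * (\<Sum>i\<in>insert j I. (x(j := y)) i))) * indicator (E j) (x(j := y))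
            \<le> ennreal K * indicator {u<..} y
              * (ennreal (exp (- \<theta> * ((\<Sum>i\<in>I. x i) - ?a))) * indicator {?a<..} (\<Sum>i\<in>I. x i))"
            unfolding s using K by (auto simp: indicator_def ennreal_mult)
        qed
        also have "\<dots> = ennreal K * indicator {u<..} y
            * (\<integral>\<^sup>+x. ennreal (exp (- \<theta> * ((\<Sum>i\<in>I. x i) - ?a))) * indicator {?a<..} (\<Sum>i\<in>I. x i) \<partial>PiM I (\<lambda>_. tilt F \<theta>))"
          by (rule nn_integral_cmult) measurable
        also have "\<dots> \<le> ennreal K * indicator {u<..} y * ennreal (C / sqrt (card I))"
          by (intro mult_left_mono tail I(1) I0) auto
        also have "\<dots> = ennreal (K * (C / sqrt (real n - 1))) * indicator {u<..} y"
        proof -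
          have "ennreal (K * (C / sqrt (real n - 1))) = ennreal K * ennreal (C / sqrt (card I))"
            using K C n by (simp only: I(4)) (subst ennreal_mult[symmetric], auto simp: of_nat_diff)
          then show ?thesis by (simp only: mult_ac)
        qed
        finally show "(\<integral>\<^sup>+x. ennreal (M ^ n * exp (- \<theta> * (\<Sum>i\<in>insert j I. (x(j := y)) i))) * indicator (E j) (x(j := y)) \<partial>PiM I (\<lambda>_. tilt F \<theta>))
          \<le> ennreal (K * (C / sqrt (real n - 1))) * indicator {u<..} y" .
      qed
      also have "\<dots> = ennreal (K * (C / sqrt (real n - 1))) * emeasure (tilt F \<theta>) {u<..}"
        by (rule nn_integral_cmult_indicator) simp
      also have "\<dots> \<le> ennreal (K * (C / sqrt (real n - 1))) * ennreal (exp (- \<theta>' * u) * B)"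
        unfolding B_def M_def by (intro mult_left_mono emeasure_tilt_greaterThan_le th th' pos') auto
      also have "\<dots> = ennreal (K * (exp (- \<theta>' * u) * B) * (C / sqrt (real n - 1)))"
        using K C B n by (subst ennreal_mult[symmetric]) (auto simp: mult_ac)
      finally show ?thesis
        using K C B n by (subst (asm) PF.emeasure_eq_measure, subst (asm) ennreal_le_iff) auto
    qed
    have "{x \<in> space ?PF. b * n < (\<Sum>i<n. x i) \<and> (\<exists>i<n. u < x i)} = (\<Union>j\<in>{..<n}. E j)"
      by (auto simp: E_def)
    also have "PF.prob \<dots> \<le> (\<Sum>j<n. PF.prob (E j))"
      by (intro PF.finite_measure_subadditive_finite) auto
    also have "\<dots> \<le> (\<Sum>j<n. K * (exp (- \<theta>' * u) * B) * (C / sqrt (real n - 1)))"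
      using one by (intro sum_mono) auto
    also have "\<dots> = K * (exp (- \<theta>' * u) * B * n) * (C / sqrt (real n - 1))" by simp
    also have "\<dots> \<le> K * (exp (- \<theta>' * u) * B * n) * (C * sqrt 2 / sqrt n)"
    proof (rule mult_left_mono)
      \<comment> \<open>From \<open>n \<le> 2 * (n - 1)\<close>, which holds as
        \<open>2 \<le> n\<close>.\<close>
      have "sqrt n \<le> sqrt 2 * sqrt (real n - 1)"
        unfolding real_sqrt_mult[symmetric] using n by simp
      then show "C / sqrt (real n - 1) \<le> C * sqrt 2 / sqrt n"
        using C n by (simp add: field_simps)
      show "0 \<le> K * (exp (- \<theta>' * u) * B * n)" using K B by simp
    qed
    also have "\<dots> = M ^ n * exp (- \<theta> * (b * n)) * (B * C * sqrt 2 * (n * exp (- \<theta>' * u)) / sqrt n)"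
      by (simp add: K_def)
    finally show "PF.prob {x \<in> space ?PF. b * n < (\<Sum>i<n. x i) \<and> (\<exists>i<n. u < x i)}
        \<le> (\<integral>x. exp (\<theta> * x) \<partial>F) ^ n * exp (- \<theta> * (b * n)) * (B * C * sqrt 2 * (n * exp (- \<theta>' * u)) / sqrt n)"
      by (simp add: M_def)
  qed
qed

end

subsection \<open>Truncation\<close>

text \<open>Markov's inequality again, now under \<open>F\<close> itself. It serves to show that the
  normalising power \<open>measure F {..u} ^ n\<close> is close to 1.\<close>

lemma prob_greaterThan_le:
  assumes F: "prob_space F" and sF: "sets F = sets borel" and th: "\<theta> \<in> cgf_dom F"
    and pos: "0 < \<theta>"
  shows "measure F {u<..} \<le> exp (- \<theta> * u) * (\<integral>x. exp (\<theta> * x) \<partial>F)"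
proof -
  interpret F: prob_space F by fact
  note sF[measurable_cong]
  have "measure F {u<..} = (\<integral>x. indicator {u<..} x \<partial>F)" by (simp add: sF)
  also have "\<dots> \<le> (\<integral>x. exp (- \<theta> * u) * exp (\<theta> * x) \<partial>F)"
  proof (rule integral_mono)
    show "integrable F (indicator {u<..} :: real \<Rightarrow> real)"
      by (rule integrable_real_indicator) (auto simp: sF F.emeasure_eq_measure)
    show "integrable F (\<lambda>x. exp (- \<theta> * u) * exp (\<theta> * x))"
      using integrable_exp_cgf_dom[OF F sF th] by simp
    show "indicator {u<..} x \<le> exp (- \<theta> * u) * exp (\<theta> * x)" for x
      using pos by (auto simp: indicator_def exp_add[symmetric])
  qed
  finally show ?thesis by simp
qed

text \<open>Truncation conditions every coordinate on \<open>{..u}\<close>. This separates its two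
  effects: samples with a big jump are lost, and the rest is scaled up by the normalising
  power.\<close>

lemma tail_prob_trunc_distr:
  fixes n :: nat
  assumes F: "prob_space F" and sF: "sets F = sets borel" and pos: "0 < measure F {..u}"
  defines "P \<equiv> PiM {..<n} (\<lambda>_. F)"
  shows "tail_prob n \<gamma> (trunc_distr F u)
    = measure P {x \<in> space P. \<gamma> < (\<Sum>i<n. x i) \<and> (\<forall>i<n. x i \<le> u)} / measure F {..u} ^ n"
proof -
  note sF[measurable_cong]
  have "space (PiM {..<n} (\<lambda>_. uniform_measure F {..u})) = space P"
    unfolding P_def by (intro sets_eq_imp_space_eq sets_PiM_cong) auto
  moreover have "{x \<in> space P. \<gamma> < (\<Sum>i<n. x i)} \<in> sets P"
    unfolding P_def by measurable
  ultimately show ?thesis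
    unfolding tail_prob_def trunc_distr_def
    using measure_PiM_uniform_measure[OF F _ pos finite_lessThan, of "{x \<in> space P. \<gamma> < (\<Sum>i<n. x i)}" n]
    by (simp add: P_def sF Ball_def conj_ac cong: conj_cong)
qed

theorem theorem3:
  fixes F :: "real measure" and b \<theta>s :: real and u :: "nat \<Rightarrow> real"
  assumes prob: "prob_space F"
    and borel: "sets F = sets borel"
    and b_gt_mean: "b > (\<integral>x. x \<partial>F)"
    and lat: "(lattice_distr F \<and> 0 < measure F {b} \<and> measure F {b} < 1) \<or> \<not> lattice_distr F"
    and zero_int: "0 \<in> interior (cgf_dom F)"
    and ts_int: "\<theta>s \<in> interior (cgf_dom F)"
    and ts_deriv: "(cgf F has_real_derivative b) (at \<theta>s)"
    and ts_unique: "\<And>\<theta>. \<theta> \<in> interior (cgf_dom F) \<Longrightarrow>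
                    (cgf F has_real_derivative b) (at \<theta>) \<Longrightarrow> \<theta> = \<theta>s"
    and trunc: "\<exists>\<theta>'>0. \<theta>s + \<theta>' \<in> interior (cgf_dom F) \<and>
                  (\<lambda>n. real n * exp (- \<theta>' * u n)) \<longlonglongrightarrow> 0"
  shows "(\<lambda>n. tail_prob n (b * real n) (trunc_distr F (u n)) - tail_prob n (b * real n) F)
           \<in> o(\<lambda>n. tail_prob n (b * real n) F)"
proof -
  interpret F: prob_space F by (rule prob)
  note borel[measurable_cong]
  obtain \<theta>' where \<theta>': "0 < \<theta>'" and sum_int: "\<theta>s + \<theta>' \<in> interior (cgf_dom F)"
    and lim: "(\<lambda>n. real n * exp (- \<theta>' * u n)) \<longlonglongrightarrow> 0"
    using trunc by blast
  have dom: "\<theta>s \<in> cgf_dom F" "\<theta>s + \<theta>' \<in> cgf_dom F"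
    using ts_int sum_int interior_subset by blast+
  \<comment> \<open>A point mass at \<open>b\<close> is lattice, for instance with
    \<open>h = 1\<close>, and gives \<open>{b}\<close> measure 1; this contradicts both alternatives
    of \<open>lat\<close>.\<close>
  have nd: "\<not> (AE x in F. x = b)"
  proof
    assume AE: "AE x in F. x = b"
    then have "AE x in F. (x - b) / 1 \<in> \<int>" by (rule eventually_mono) simp
    then have "lattice_distr F" unfolding lattice_distr_def by (intro exI[of _ b] exI[of _ 1]) simp
    moreover have "measure F {b} = 1" using AE by (subst F.prob_eq_1) (auto simp: borel)
    ultimately show False using lat by simp
  qed
  have pos: "0 < \<theta>s"
    by (rule saddle_point_pos[OF prob borel ts_int zero_int
          saddle_point_mean[OF prob borel ts_int ts_deriv] b_gt_mean])
  define M where "M = (\<integral>x. exp (\<theta>s * x) \<partial>F)"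
  have M: "0 < M" unfolding M_def by (rule integral_exp_pos[OF prob borel dom(1)])
  obtain c where c: "0 < c" and lower:
    "\<forall>\<^sub>F n in sequentially. M ^ n * exp (- \<theta>s * (b * n)) * (c / sqrt n) \<le> tail_prob n (b * n) F"
    unfolding M_def by (rule tail_prob_ge[OF prob borel ts_int ts_deriv nd pos]) blast
  define P where "P n = PiM {..<n} (\<lambda>_::nat. F)" for n
  obtain C where C: "0 < C" and upper: "\<And>n u. 2 \<le> n \<Longrightarrow>
      measure (P n) {x \<in> space (P n). b * n < (\<Sum>i<n. x i) \<and> (\<exists>i<n. u < x i)}
        \<le> M ^ n * exp (- \<theta>s * (b * n)) * (C * (n * exp (- \<theta>' * u)) / sqrt n)"
    unfolding M_def P_def
    by (rule prob_big_jump_le[OF prob borel ts_int ts_deriv nd pos dom(2) \<theta>']) blast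
  define M' where "M' = (\<integral>x. exp ((\<theta>s + \<theta>') * x) \<partial>F)"
  have M': "0 < M'" unfolding M'_def by (rule integral_exp_pos[OF prob borel dom(2)])
  show ?thesis
  proof (rule landau_o.smallI)
    fix \<epsilon> :: real
    assume \<epsilon>: "0 < \<epsilon>"
    \<comment> \<open>Solves \<open>1 / (1 - \<delta>) = 1 + \<epsilon>\<close>. Bernoulli's
      inequality will give \<open>1 - \<delta> \<le> q ^ n\<close>, so that dividing by
      \<open>q ^ n\<close> costs at most the factor \<open>1 + \<epsilon>\<close>.\<close>
    define \<delta> where "\<delta> = \<epsilon> / (1 + \<epsilon>)"
    have \<delta>: "0 < \<delta>" "\<delta> < 1" unfolding \<delta>_def using \<epsilon> by auto
    \<comment> \<open>The three thresholds make, in this order, \<open>u n\<close> positive, the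
      big-jump probability at most \<open>\<epsilon> * p\<close>, and
      \<open>n * measure F {u n<..}\<close> at most \<open>\<delta>\<close>.\<close>
    have "\<forall>\<^sub>F n in sequentially. real n * exp (- \<theta>' * u n) < 1"
      by (rule order_tendstoD(2)[OF lim]) simp
    moreover have "\<forall>\<^sub>F n in sequentially. real n * exp (- \<theta>' * u n) < \<epsilon> * c / C"
      using \<epsilon> c C by (intro order_tendstoD(2)[OF lim]) simp
    moreover have "\<forall>\<^sub>F n in sequentially. real n * exp (- \<theta>' * u n) < \<delta> / M'"
      using \<delta> M' by (intro order_tendstoD(2)[OF lim]) simp
    ultimately show "\<forall>\<^sub>F n in sequentially.
      norm (tail_prob n (b * real n) (trunc_distr F (u n)) - tail_prob n (b * real n) F)
        \<le> \<epsilon> * norm (tail_prob n (b * real n) F)"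
      using lower eventually_ge_at_top[of 2]
    proof eventually_elim
      case (elim n)
      interpret P: prob_space "P n" unfolding P_def by (intro prob_space_PiM prob)
      have n: "0 < n" using elim by simp
      define p where "p = tail_prob n (b * n) F"
      define J where "J = {x \<in> space (P n). b * n < (\<Sum>i<n. x i) \<and> (\<exists>i<n. u n < x i)}"
      define T where "T = {x \<in> space (P n). b * n < (\<Sum>i<n. x i) \<and> (\<forall>i<n. x i \<le> u n)}"
      define q where "q = measure F {..u n}"
      have meas: "J \<in> sets (P n)" "T \<in> sets (P n)"
      proof -
        have "{x \<in> space (P n). b * n < (\<Sum>i<n. x i) \<and> (\<exists>i\<in>{..<n}. u n < x i)} \<in> sets (P n)"
          "{x \<in> space (P n). b * n < (\<Sum>i<n. x i) \<and> (\<forall>i\<in>{..<n}. x i \<le> u n)} \<in> sets (P n)"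
          unfolding P_def by measurable
        then show "J \<in> sets (P n)" "T \<in> sets (P n)"
          by (simp_all add: J_def T_def Ball_def Bex_def)
      qed
      have p: "p = P.prob T + P.prob J"
      proof -
        have "{x \<in> space (P n). b * n < (\<Sum>i<n. x i)} = T \<union> J"
          by (auto simp: T_def J_def not_less)
        moreover have "T \<inter> J = {}" by (auto simp: T_def J_def)
        ultimately show ?thesis
          using P.finite_measure_Union[OF meas(2,1)] by (simp add: p_def tail_prob_def P_def)
      qed
      have J_le: "P.prob J \<le> \<epsilon> * p"
      proof -
        have "P.prob J \<le> M ^ n * exp (- \<theta>s * (b * n)) * (C * (n * exp (- \<theta>' * u n)) / sqrt n)"
          unfolding J_def using elim by (intro upper) auto
        also have "\<dots> \<le> M ^ n * exp (- \<theta>s * (b * n)) * (\<epsilon> * c / sqrt n)"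
          using elim C M by (intro mult_left_mono divide_right_mono) (auto simp: field_simps)
        also have "\<dots> = \<epsilon> * (M ^ n * exp (- \<theta>s * (b * n)) * (c / sqrt n))" by simp
        also have "\<dots> \<le> \<epsilon> * p" using elim \<epsilon> by (intro mult_left_mono) (auto simp: p_def)
        finally show ?thesis .
      qed
      \<comment> \<open>Positivity of \<open>u n\<close> lets the factor
        \<open>exp (- \<theta>s * u n)\<close> be dropped from the Chernoff bound for
        \<open>F\<close>, so that the same quantity \<open>n * exp (- \<theta>' * u n)\<close>
        controls the normalisation.\<close>
      have "exp (- \<theta>' * u n) \<le> real n * exp (- \<theta>' * u n)" using n by simp
      with elim have "exp (- \<theta>' * u n) < 1" by linarith
      then have u: "0 < u n" using \<theta>' by (simp add: zero_less_mult_iff)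
      have "{..u n} = space F - {u n<..}" using sets_eq_imp_space_eq[OF borel] by auto
      then have q_eq: "q = 1 - measure F {u n<..}"
        unfolding q_def by (subst F.prob_compl[symmetric]) (auto simp: borel)
      have "measure F {u n<..} \<le> exp (- (\<theta>s + \<theta>') * u n) * M'"
        unfolding M'_def using pos \<theta>' by (intro prob_greaterThan_le prob borel dom) auto
      also have "\<dots> \<le> exp (- \<theta>' * u n) * M'"
        using u pos M' by (intro mult_right_mono) (auto simp: algebra_simps)
      finally have "n * measure F {u n<..} \<le> n * (exp (- \<theta>' * u n) * M')" by (rule mult_left_mono) simp
      also have "\<dots> \<le> \<delta>" using elim M' by (simp add: field_simps)
      finally have "1 - \<delta> \<le> 1 + n * (- measure F {u n<..})" by simp
      also have "\<dots> \<le> (1 + - measure F {u n<..}) ^ n"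
        by (rule Bernoulli_inequality) simp
      also have "\<dots> = q ^ n" by (simp add: q_eq)
      finally have qn: "1 / (1 + \<epsilon>) \<le> q ^ n" using \<epsilon> by (simp add: \<delta>_def field_simps)
      have "0 < q ^ n" using qn \<epsilon> by (smt (verit) divide_pos_pos)
      then have "q \<noteq> 0" using n by (auto simp: power_0_left)
      then have q: "0 < q" unfolding q_def by (simp add: zero_less_measure_iff)
      have qn1: "q ^ n \<le> 1" unfolding q_def by (intro power_le_one) auto
      have trunc_eq: "tail_prob n (b * n) (trunc_distr F (u n)) = P.prob T / q ^ n"
        using tail_prob_trunc_distr[OF prob borel q[unfolded q_def]] by (simp add: T_def P_def q_def)
      \<comment> \<open>Below, the truncated probability is at least
        \<open>P.prob T = p - P.prob J\<close>, hence at least \<open>(1 - \<epsilon>) * p\<close>.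
        Above, normalisation inflates \<open>P.prob T \<le> p\<close> by at most
        \<open>1 + \<epsilon>\<close>.\<close>
      have "P.prob T \<le> P.prob T / q ^ n"
        using \<open>0 < q ^ n\<close> qn1 by (simp add: le_divide_eq mult_left_le)
      moreover have "P.prob T / q ^ n \<le> P.prob T * (1 + \<epsilon>)"
      proof -
        have "1 / q ^ n \<le> 1 + \<epsilon>" using qn \<epsilon> \<open>0 < q ^ n\<close> by (simp add: field_simps)
        from mult_left_mono[OF this, of "P.prob T"] show ?thesis by simp
      qed
      moreover have "P.prob T * (1 + \<epsilon>) \<le> p * (1 + \<epsilon>)"
        using \<epsilon> by (intro mult_right_mono) (auto simp: p)
      moreover have "0 \<le> p" by (simp add: p)
      ultimately have "\<bar>P.prob T / q ^ n - p\<bar> \<le> \<epsilon> * \<bar>p\<bar>"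
        using J_le p by (simp add: abs_le_iff algebra_simps)
      then show ?case by (simp add: trunc_eq p_def)
    qed
  qed
qed

end
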